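(* Let $s\ge 2$. There exists a constant $C\ge 0$ such that for every point $x\in\mathcal{T}_s$, $$(s-1)\,\bar f_{s-1}(x)-C\ \le\ \bar f_1(x)\ \le\ \frac{1}{s-1}\,\bar f_{s-1}(x)+C .$$
   Context: Let $\mathcal{P}_s$ be the space of positive definite quadratic forms of determinant one on $\mathbb{R}^s$, identified with their matrices in the canonical basis. It carries the metric $d(Q_1,Q_2)=\sqrt{\sum_{i=1}^s(\ln\lambda_i)^2}$, where $\lambda_1,\dots,\lambda_s>0$ are the diagonal coefficients of $Q_2$ in a $Q_1$-orthonormal basis in which $Q_2$ is diagonal. The group $SL(s,\mathbb{R})$ acts isometrically on the right by $Q\cdot B=B^TQB$ (i.e. $Q\circ B$). Let $\Gamma=SL(s,\mathbb{Z})$, let $\mathcal{T}_s=\mathcal{P}_s/\Gamma$ with the quotient metric $\mathrm{dist}$, and let $\mathrm{proj}:\mathcal{P}_s\to\mathcal{T}_s$ be the projection. For $i\in\{1,\dots,s-1\}$ let $r_i$ be the unit speed geodesic ray in $\mathcal{P}_s$ given by $$r_i(t)=\mathrm{diag}(\underbrace{e^{\lambda_i t},\dots,e^{\lambda_i t}}_{s-i},\underbrace{e^{-\mu_i t},\dots,e^{-\mu_i t}}_{i}),\quad t\ge 0,\qquad \lambda_i=\sqrt{\tfrac{i}{s(s-i)}},\quad \mu_i=\sqrt{\tfrac{s-i}{si}},$$ and let $\bar r_i=\mathrm{proj}\circ r_i$, which is a geodesic ray in $\mathcal{T}_s$. The Busemann function of $\bar r_i$ is $\bar f_i:\mathcal{T}_s\to\mathbb{R}$,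 $\bar f_i(x)=\lim_{t\to\infty}[\mathrm{dist}(x,\bar r_i(t))-t]$. *)

theory Defs
  imports Complex_Main "Jordan_Normal_Form.Determinant"
begin

definition posdef_mat :: "nat \<Rightarrow> real mat \<Rightarrow> bool" where
  "posdef_mat s Q \<longleftrightarrow> Q \<in> carrier_mat s s \<and> Q\<^sup>T = Q \<and>
     (\<forall>v \<in> carrier_vec s. v \<noteq> 0\<^sub>v s \<longrightarrow> v \<bullet> (Q *\<^sub>v v) > 0)"

definition forms :: "nat \<Rightarrow> real mat set" where
  "forms s = {Q. posdef_mat s Q \<and> det Q = 1}"

definition form_act :: "real mat \<Rightarrow> real mat \<Rightarrow> real mat" where
  "form_act Q B = B\<^sup>T * Q * B"

(* The columns of P are a Q1-orthonormal basis in which Q2 is diagonal.  The value r does not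
   depend on P when Q1 and Q2 are positive definite. *)
definition form_dist :: "nat \<Rightarrow> real mat \<Rightarrow> real mat \<Rightarrow> real" where
  "form_dist s Q1 Q2 = (THE r. \<exists>P \<in> carrier_mat s s.
     form_act Q1 P = 1\<^sub>m s \<and> diagonal_mat (form_act Q2 P) \<and>
     r = sqrt (\<Sum>i<s. (ln (form_act Q2 P $$ (i, i)))\<^sup>2))"

definition SLZ :: "nat \<Rightarrow> int mat set" where
  "SLZ s = {B \<in> carrier_mat s s. det B = 1}"

(* Points of the quotient are the orbits themselves. *)
definition form_proj :: "nat \<Rightarrow> real mat \<Rightarrow> real mat set" where
  "form_proj s Q = (\<lambda>B. form_act Q (map_mat real_of_int B)) ` SLZ s"

definition form_quotient :: "nat \<Rightarrow> real mat set set" where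
  "form_quotient s = form_proj s ` forms s"

definition quot_dist :: "nat \<Rightarrow> real mat set \<Rightarrow> real mat set \<Rightarrow> real" where
  "quot_dist s x y = (INF (Q1, Q2) \<in> x \<times> y. form_dist s Q1 Q2)"

definition ray :: "nat \<Rightarrow> nat \<Rightarrow> real \<Rightarrow> real mat" where
  "ray s i t = mat_diag s (\<lambda>j.
     if j < s - i then exp (sqrt (real i / (real s * (real s - real i))) * t)
     else exp (- sqrt ((real s - real i) / (real s * real i)) * t))"

definition quot_ray :: "nat \<Rightarrow> nat \<Rightarrow> real \<Rightarrow> real mat set" where
  "quot_ray s i t = form_proj s (ray s i t)"

definition busemann :: "nat \<Rightarrow> nat \<Rightarrow> real mat set \<Rightarrow> real" where
  "busemann s i x = Lim at_top (\<lambda>t. quot_dist s x (quot_ray s i t) - t)"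

end

theory Submission
  imports Defs "Jordan_Normal_Form.Spectral_Radius"
begin

text \<open>For a positive definite form \<open>Q\<close> of determinant one write \<open>log_min s Q\<close> for the infimum of
\<open>ln Q(w)\<close> over the primitive integer vectors \<open>w\<close>, and put \<open>c = sqrt (s / (s - 1))\<close>. Both
Busemann functions can be computed exactly: at the class of \<open>Q\<close> the first one equals
\<open>c * log_min s Q\<close> and the last one equals \<open>c * log_min s R\<close>, where \<open>R\<close> is the inverse of \<open>Q\<close>
(lemmas \<open>busemann_first_ray\<close> and \<open>busemann_last_ray\<close>). The theorem therefore compares the
minimum of a lattice with the minimum of its dual lattice. Both inequalities are the bound
\<open>(s - 1) * log_min s Q \<le> log_min s R + C\<close>, used once for \<open>(Q, R)\<close> and once for \<open>(R, Q)\<close>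
(\<open>log_min_transference\<close>).

That bound is Hermite's inequality in dimension \<open>s - 1\<close>. A unimodular change of basis turns a given
primitive vector \<open>v\<close> into the first basis vector, so that \<open>R(v)\<close> becomes the corner entry of the
inverse of \<open>Q\<close>, which is the determinant of the minor of \<open>Q\<close> without its first row and column. By
\<open>hermite_bound\<close> this minor, which is \<open>Q\<close> restricted to an integral hyperplane, takes at some
primitive vector a value of order at most the \<open>(s - 1)\<close>-th root of \<open>R(v)\<close>.

For the Busemann functions, consider the ray that contracts the \<open>k\<close>-th axis and expands all others
equally (\<open>contracting_ray\<close>). The first ray is of this kind, and so is the inverse of the last one;
inversion preserves the distance (\<open>quot_dist_inverse\<close>). If \<open>d\<close> lists the eigenvalues of \<open>Q2\<close>
relative to \<open>Q1\<close>, the numbers \<open>ln (d i)\<close> have sum zero, hence by Cauchy-Schwarz the distance is at least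
\<open>c\<close> times the absolute value of each of them. The least eigenvalue is at most \<open>Q2(v) / Q1(v)\<close> for
every \<open>v\<close>, whence \<open>form_dist_lower_bound\<close>: the distance is at least
\<open>c * (ln Q1(v) - ln Q2(v))\<close>. Along a contracting ray, with \<open>v\<close> the contracted axis, this bound is sharp in the
limit, because the other eigenvalues stay equal up to bounded factors
(\<open>form_dist_contracting_ray_upper\<close>). Moving \<open>v\<close> by the unimodular group runs through the primitive
vectors, so the lower bound holds on the quotient uniformly in \<open>t\<close>; with the
upper bound this gives the existence and the value of the limit
(\<open>quot_dist_contracting_ray_tendsto\<close>).\<close>

section \<open>Values of quadratic forms under linear substitutions\<close>

definition qf :: "real mat \<Rightarrow> real vec \<Rightarrow> real" where
  "qf Q v = v \<bullet> (Q *\<^sub>v v)"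

lemma qf_sum:
  assumes "Q \<in> carrier_mat n n" "v \<in> carrier_vec n"
  shows "qf Q v = (\<Sum>i<n. \<Sum>j<n. Q $$ (i,j) * (v $ i * v $ j))"
  using assms unfolding qf_def
  by (auto simp: scalar_prod_def atLeast0LessThan sum_distrib_left algebra_simps intro!: sum.cong)

lemma qf_unit:
  assumes "Q \<in> carrier_mat n n" "k < n"
  shows "qf Q (unit_vec n k) = Q $$ (k,k)"
proof -
  have "qf Q (unit_vec n k) = (\<Sum>i<n. \<Sum>j<n. if i = k \<and> j = k then Q $$ (k,k) else 0)"
    unfolding qf_sum[OF assms(1) unit_vec_carrier] by (intro sum.cong) (auto simp: unit_vec_def)
  also have "\<dots> = (\<Sum>i<n. if i = k then Q $$ (k,k) else 0)"
    using assms(2) by (intro sum.cong) auto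
  finally show ?thesis using assms(2) by simp
qed

lemma form_act_carrier [simp]:
  "Q \<in> carrier_mat n n \<Longrightarrow> B \<in> carrier_mat n m \<Longrightarrow> form_act Q B \<in> carrier_mat m m"
  unfolding form_act_def by auto

lemma form_act_mult:
  assumes "Q \<in> carrier_mat n n" "A \<in> carrier_mat n m" "B \<in> carrier_mat m k"
  shows "form_act Q (A * B) = form_act (form_act Q A) B"
proof -
  have [simp]: "A\<^sup>T \<in> carrier_mat m n" "B\<^sup>T \<in> carrier_mat k m" using assms by auto
  show ?thesis
    unfolding form_act_def transpose_mult[OF assms(2,3)]
    using assms by (simp add: assoc_mult_mat[where ?n\<^sub>1=m and ?n\<^sub>2=n and ?n\<^sub>3=n and ?n\<^sub>4=k]
        assoc_mult_mat[where ?n\<^sub>1=k and ?n\<^sub>2=m and ?n\<^sub>3=n and ?n\<^sub>4=n]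
        assoc_mult_mat[where ?n\<^sub>1=k and ?n\<^sub>2=m and ?n\<^sub>3=n and ?n\<^sub>4=k]
        assoc_mult_mat[where ?n\<^sub>1=n and ?n\<^sub>2=n and ?n\<^sub>3=m and ?n\<^sub>4=k]
        assoc_mult_mat[where ?n\<^sub>1=m and ?n\<^sub>2=n and ?n\<^sub>3=n and ?n\<^sub>4=m]
        assoc_mult_mat[where ?n\<^sub>1=m and ?n\<^sub>2=n and ?n\<^sub>3=m and ?n\<^sub>4=k]
        assoc_mult_mat[where ?n\<^sub>1=k and ?n\<^sub>2=m and ?n\<^sub>3=m and ?n\<^sub>4=k])
qed

lemma form_act_one [simp]: "Q \<in> carrier_mat n n \<Longrightarrow> form_act Q (1\<^sub>m n) = Q"
  unfolding form_act_def by auto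

lemma form_act_sym:
  assumes "Q \<in> carrier_mat n n" "Q\<^sup>T = Q" "B \<in> carrier_mat n m"
  shows "(form_act Q B)\<^sup>T = form_act Q B"
proof -
  have [simp]: "B\<^sup>T \<in> carrier_mat m n" using assms by auto
  have "(B\<^sup>T * Q * B)\<^sup>T = B\<^sup>T * (B\<^sup>T * Q)\<^sup>T"
    by (rule transpose_mult) (use assms in auto)
  also have "(B\<^sup>T * Q)\<^sup>T = Q * B"
    using transpose_mult[of "B\<^sup>T" m n Q n] assms by simp
  finally show ?thesis unfolding form_act_def
    using assms by simp
qed

lemma mult_vec_scalar_prod:
  fixes A :: "'a :: comm_semiring_0 mat"
  assumes "A \<in> carrier_mat n m" "v \<in> carrier_vec m" "w \<in> carrier_vec n"
  shows "(A *\<^sub>v v) \<bullet> w = v \<bullet> (A\<^sup>T *\<^sub>v w)"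
proof -
  have "(A\<^sup>T *\<^sub>v w) \<bullet> v = w \<bullet> (A *\<^sub>v v)"
    by (rule transpose_vec_mult_scalar[OF assms])
  then show ?thesis using assms
    by (simp add: comm_scalar_prod[of v m] comm_scalar_prod[of "A *\<^sub>v v" n])
qed

lemma form_act_vec:
  assumes "Q \<in> carrier_mat n n" "A \<in> carrier_mat n m" "v \<in> carrier_vec m"
  shows "form_act Q A *\<^sub>v v = A\<^sup>T *\<^sub>v (Q *\<^sub>v (A *\<^sub>v v))"
proof -
  have [simp]: "A\<^sup>T \<in> carrier_mat m n" using assms by auto
  show ?thesis
    unfolding form_act_def using assms
    by (simp add: assoc_mult_mat[of "A\<^sup>T" m n Q n A m] assoc_mult_mat_vec[of "A\<^sup>T" m n "Q * A" m]
        assoc_mult_mat_vec[of Q n n A m])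
qed

lemma qf_form_act:
  assumes "Q \<in> carrier_mat n n" "A \<in> carrier_mat n m" "v \<in> carrier_vec m"
  shows "qf (form_act Q A) v = qf Q (A *\<^sub>v v)"
  unfolding qf_def form_act_vec[OF assms]
  using mult_vec_scalar_prod[of A n m v "Q *\<^sub>v (A *\<^sub>v v)"] assms by simp

lemma posdef_matD:
  assumes "posdef_mat n Q"
  shows "Q \<in> carrier_mat n n" "Q\<^sup>T = Q"
    "\<And>v. v \<in> carrier_vec n \<Longrightarrow> v \<noteq> 0\<^sub>v n \<Longrightarrow> qf Q v > 0"
  using assms unfolding posdef_mat_def qf_def by auto

lemma posdef_matI:
  assumes "Q \<in> carrier_mat n n" "Q\<^sup>T = Q"
    "\<And>v. v \<in> carrier_vec n \<Longrightarrow> v \<noteq> 0\<^sub>v n \<Longrightarrow> qf Q v > 0"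
  shows "posdef_mat n Q"
  using assms unfolding posdef_mat_def qf_def by auto

lemma mult_vec_nonzero:
  fixes N :: "'a :: field mat"
  assumes "N \<in> carrier_mat n n" "det N \<noteq> 0" "v \<in> carrier_vec n" "v \<noteq> 0\<^sub>v n"
  shows "N *\<^sub>v v \<noteq> 0\<^sub>v n"
  using assms det_0_iff_vec_prod_zero_field[of N n] by auto

lemma posdef_form_act:
  assumes "posdef_mat n Q" "N \<in> carrier_mat n n" "det N \<noteq> 0"
  shows "posdef_mat n (form_act Q N)"
proof (rule posdef_matI)
  note Q = posdef_matD[OF assms(1)]
  show "form_act Q N \<in> carrier_mat n n" using Q assms by auto
  show "(form_act Q N)\<^sup>T = form_act Q N" by (rule form_act_sym) (use Q assms in auto)
  fix v :: "real vec" assume v: "v \<in> carrier_vec n" "v \<noteq> 0\<^sub>v n"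
  then show "qf (form_act Q N) v > 0"
    using Q(3)[of "N *\<^sub>v v"] mult_vec_nonzero[OF assms(2,3) v] assms(2)
    by (simp add: qf_form_act[OF Q(1) assms(2)])
qed

lemma det_form_act:
  assumes "Q \<in> carrier_mat n n" "N \<in> carrier_mat n n"
  shows "det (form_act Q N) = det Q * (det N)\<^sup>2"
proof -
  have [simp]: "N\<^sup>T \<in> carrier_mat n n" using assms by auto
  show ?thesis unfolding form_act_def using assms
    by (simp add: det_mult[of "N\<^sup>T * Q" n] det_mult[of "N\<^sup>T" n] det_mult[of Q n N] det_transpose[of N n] power2_eq_square)
qed

section \<open>Splitting off one variable\<close>

definition block_sum :: "real \<Rightarrow> real mat \<Rightarrow> real mat" where
  "block_sum a S = four_block_mat (mat 1 1 (\<lambda>_. a)) (0\<^sub>m 1 (dim_col S)) (0\<^sub>m (dim_row S) 1) S"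

lemma block_sum_carrier [simp]: "S \<in> carrier_mat n m \<Longrightarrow> block_sum a S \<in> carrier_mat (Suc n) (Suc m)"
  unfolding block_sum_def by (auto intro!: carrier_matI)

lemma block_sum_index:
  assumes "S \<in> carrier_mat n m" "i < Suc n" "j < Suc m"
  shows "block_sum a S $$ (i,j) = (if i = 0 then if j = 0 then a else 0
     else if j = 0 then 0 else S $$ (i - 1, j - 1))"
  using assms unfolding block_sum_def by auto

lemma block_sum_mult:
  assumes "S \<in> carrier_mat n n" "T \<in> carrier_mat n n"
  shows "block_sum a S * block_sum b T = block_sum (a * b) (S * T)"
proof -
  have [simp]: "mat (Suc 0) (Suc 0) (\<lambda>_. a) * mat (Suc 0) (Suc 0) (\<lambda>_. b) + 0\<^sub>m (Suc 0) (Suc 0)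
      = mat (Suc 0) (Suc 0) (\<lambda>_. a * b)"
    by (rule eq_matI) (auto simp: scalar_prod_def)
  show ?thesis using assms unfolding block_sum_def
    by (subst mult_four_block_mat[where ?nr1.0=1 and ?n1.0=1 and ?n2.0=n and ?nr2.0=n
          and ?nc1.0=1 and ?nc2.0=n]) auto
qed

lemma block_sum_transpose:
  assumes "S \<in> carrier_mat n n"
  shows "(block_sum a S)\<^sup>T = block_sum a (S\<^sup>T)"
proof -
  have [simp]: "(mat 1 1 (\<lambda>_. a))\<^sup>T = mat 1 1 (\<lambda>_. a)" by (rule eq_matI) auto
  show ?thesis using assms unfolding block_sum_def
    by (subst transpose_four_block_mat[where ?nr1.0=1 and ?nr2.0=n and ?nc1.0=1 and ?nc2.0=n]) auto
qed

lemma det_block_sum: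
  assumes "S \<in> carrier_mat n n"
  shows "det (block_sum a S) = a * det S"
proof -
  have "det (mat 1 1 (\<lambda>_. a)) = a" by (subst det_single) auto
  then show ?thesis using assms unfolding block_sum_def
    by (subst det_four_block_mat_lower_left_zero_col[where n=n]) auto
qed

lemma block_sum_one: "block_sum 1 (1\<^sub>m n) = 1\<^sub>m (Suc n)"
  by (rule eq_matI) (auto simp: block_sum_def)

lemma form_act_block_sum:
  assumes "S \<in> carrier_mat n n" "T \<in> carrier_mat n n"
  shows "form_act (block_sum a S) (block_sum b T) = block_sum (b * a * b) (form_act S T)"
proof -
  have "T\<^sup>T * S \<in> carrier_mat n n" using assms by auto
  then show ?thesis
    using assms unfolding form_act_def
    by (simp add: block_sum_transpose[of _ n] block_sum_mult[of _ n])
qed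

text \<open>The block form is what lets inductions on the dimension proceed: a symmetric matrix is determined
by its corner and a minor as soon as the rest of its first column vanishes.\<close>

lemma block_sum_eqI:
  assumes "T \<in> carrier_mat (Suc n) (Suc n)" "T\<^sup>T = T" "\<And>i. i < n \<Longrightarrow> T $$ (Suc i, 0) = 0"
  shows "T = block_sum (T $$ (0,0)) (mat_delete T 0 0)"
proof (rule eq_matI)
  have d: "mat_delete T 0 0 \<in> carrier_mat n n" using mat_delete_carrier[OF assms(1)] by simp
  show dims: "dim_row T = dim_row (block_sum (T $$ (0,0)) (mat_delete T 0 0))"
    "dim_col T = dim_col (block_sum (T $$ (0,0)) (mat_delete T 0 0))"
    using assms(1) block_sum_carrier[OF d, of "T $$ (0,0)"] by auto
  fix i j assume "i < dim_row (block_sum (T $$ (0,0)) (mat_delete T 0 0))"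
    "j < dim_col (block_sum (T $$ (0,0)) (mat_delete T 0 0))"
  then have ij: "i < Suc n" "j < Suc n" using dims assms(1) by auto
  have sym: "T $$ (0, Suc k) = 0" if "k < n" for k
    using assms(3)[OF that] arg_cong[OF assms(2), of "\<lambda>M. M $$ (0, Suc k)"] assms(1) that by auto
  show "T $$ (i,j) = block_sum (T $$ (0,0)) (mat_delete T 0 0) $$ (i,j)"
    unfolding block_sum_index[OF d ij]
    using ij assms(1) assms(3)[of "i - 1"] sym[of "j - 1"]
    by (cases i; cases j) (auto simp: mat_delete_def)
qed

lemma qf_block_sum:
  assumes "S \<in> carrier_mat n n" "y \<in> carrier_vec n"
  shows "qf (block_sum a S) (vCons x y) = a * x\<^sup>2 + qf S y"
proof -
  have "vCons x y \<in> carrier_vec (Suc n)" using assms by auto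
  show ?thesis
    unfolding qf_sum[OF block_sum_carrier[OF assms(1)] \<open>vCons x y \<in> _\<close>] qf_sum[OF assms]
    by (simp del: sum.lessThan_Suc add: sum.lessThan_Suc_shift block_sum_index[OF assms(1)] power2_eq_square)
qed

lemma qf_vCons_0:
  assumes "Q \<in> carrier_mat (Suc n) (Suc n)" "y \<in> carrier_vec n"
  shows "qf (mat_delete Q 0 0) y = qf Q (vCons 0 y)"
proof -
  have d: "mat_delete Q 0 0 \<in> carrier_mat n n" using mat_delete_carrier[OF assms(1)] by simp
  have "vCons 0 y \<in> carrier_vec (Suc n)" using assms by auto
  from qf_sum[OF assms(1) this] show ?thesis
    using assms unfolding qf_sum[OF d assms(2)]
    by (simp del: sum.lessThan_Suc add: sum.lessThan_Suc_shift mat_delete_def)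
qed

lemma posdef_mat_delete:
  assumes "posdef_mat (Suc n) Q"
  shows "posdef_mat n (mat_delete Q 0 0)"
proof (rule posdef_matI)
  note Q = posdef_matD[OF assms]
  show "mat_delete Q 0 0 \<in> carrier_mat n n" using mat_delete_carrier[OF Q(1)] by simp
  show "(mat_delete Q 0 0)\<^sup>T = mat_delete Q 0 0"
  proof (rule eq_matI)
    fix i j assume "i < dim_row (mat_delete Q 0 0)" "j < dim_col (mat_delete Q 0 0)"
    then show "(mat_delete Q 0 0)\<^sup>T $$ (i, j) = mat_delete Q 0 0 $$ (i, j)"
      using arg_cong[OF Q(2), of "\<lambda>M. M $$ (Suc i, Suc j)"] Q(1) by (auto simp: mat_delete_def)
  qed (use Q(1) in auto)
  fix y :: "real vec" assume y: "y \<in> carrier_vec n" "y \<noteq> 0\<^sub>v n"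
  then have "vCons 0 y \<noteq> 0\<^sub>v (Suc n)" by (simp add: zero_vec_Suc)
  then show "0 < qf (mat_delete Q 0 0) y"
    using y Q(3)[of "vCons 0 y"] by (simp add: qf_vCons_0[OF Q(1)])
qed

lemma posdef_diag_pos:
  assumes "posdef_mat n Q" "k < n"
  shows "Q $$ (k,k) > 0"
  using posdef_matD[OF assms(1)] qf_unit[of Q n k] assms(2)
  by (metis unit_vec_carrier unit_vec_nonzero)

text \<open>One step of completing the square: adding multiples of the first basis vector to the others makes
them orthogonal to it. The substitution is unimodular and changes only the first coordinate, so it
preserves determinants and can be controlled on integer vectors.\<close>

lemma gauss_step:
  assumes "posdef_mat (Suc n) Q"
  obtains U S b where "U \<in> carrier_mat (Suc n) (Suc n)" "det U = 1" "b \<in> carrier_vec n"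
    "\<And>x y. y \<in> carrier_vec n \<Longrightarrow> U *\<^sub>v vCons x y = vCons (x - b \<bullet> y) y"
    "form_act Q U = block_sum (Q $$ (0,0)) S" "posdef_mat n S"
proof -
  note Q = posdef_matD[OF assms]
  have a: "Q $$ (0,0) > 0" by (rule posdef_diag_pos[OF assms]) simp
  define b where "b = vec n (\<lambda>j. Q $$ (0, Suc j) / Q $$ (0,0))"
  define U where "U = mat (Suc n) (Suc n)
    (\<lambda>(i,j). if i = j then 1 else if i = 0 then - (b $ (j - 1)) else 0)"
  have U: "U \<in> carrier_mat (Suc n) (Suc n)" unfolding U_def by simp
  have det: "det U = 1"
    by (subst det_upper_triangular[OF _ U])
       (auto simp: U_def prod_list_diag_prod)
  have vec: "U *\<^sub>v vCons x y = vCons (x - b \<bullet> y) y" if y: "y \<in> carrier_vec n" for x y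
  proof (rule eq_vecI)
    fix i assume "i < dim_vec (vCons (x - b \<bullet> y) y)"
    then have i: "i < Suc n" using y by simp
    have "(U *\<^sub>v vCons x y) $ i = (\<Sum>j<Suc n. U $$ (i,j) * vCons x y $ j)"
      using i y U by (auto simp: scalar_prod_def atLeast0LessThan intro!: sum.cong)
    also have "\<dots> = vCons (x - b \<bullet> y) y $ i"
      using i y by (cases i)
        (auto simp del: sum.lessThan_Suc simp: sum.lessThan_Suc_shift U_def scalar_prod_def atLeast0LessThan b_def
          sum_negf if_distrib[where f="\<lambda>u. u * z" for z] cong: if_cong)
    finally show "(U *\<^sub>v vCons x y) $ i = vCons (x - b \<bullet> y) y $ i" .
  qed (use U y in auto)
  let ?T = "form_act Q U"
  have T: "?T \<in> carrier_mat (Suc n) (Suc n)" using Q U by auto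
  have sym: "?T\<^sup>T = ?T" by (rule form_act_sym[OF Q(1,2) U])
  have e0: "unit_vec (Suc n) 0 = vCons 1 (0\<^sub>v n :: real vec)"
    by (rule eq_vecI) (auto simp: unit_vec_def vCons_def split: nat.split)
  have Ue0: "U *\<^sub>v unit_vec (Suc n) 0 = unit_vec (Suc n) 0"
    unfolding e0 by (subst vec) (auto simp: b_def)
  have Tv: "?T *\<^sub>v unit_vec (Suc n) 0 = U\<^sup>T *\<^sub>v (Q *\<^sub>v unit_vec (Suc n) 0)"
    using form_act_vec[OF Q(1) U unit_vec_carrier, of 0] unfolding Ue0 .
  have col: "?T $$ (i, 0) = (\<Sum>k<Suc n. U $$ (k,i) * Q $$ (k,0))" if i: "i < Suc n" for i
  proof -
    have "?T $$ (i, 0) = (?T *\<^sub>v unit_vec (Suc n) 0) $ i"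
      using i T by (auto simp: scalar_prod_def unit_vec_def if_distrib cong: if_cong)
    also have "\<dots> = (\<Sum>k<Suc n. U $$ (k,i) * (Q *\<^sub>v unit_vec (Suc n) 0) $ k)"
      unfolding Tv using i U Q(1) by (auto simp: scalar_prod_def atLeast0LessThan intro!: sum.cong)
    also have "\<dots> = (\<Sum>k<Suc n. U $$ (k,i) * Q $$ (k,0))"
      using Q(1) by (intro sum.cong)
        (auto simp: scalar_prod_def unit_vec_def if_distrib cong: if_cong)
    finally show ?thesis .
  qed
  have Qs: "Q $$ (Suc i, 0) = Q $$ (0, Suc i)" if "i < n" for i
    using arg_cong[OF Q(2), of "\<lambda>M. M $$ (0, Suc i)"] Q(1) that by auto
  have c0: "?T $$ (Suc i, 0) = 0" if "i < n" for i
    unfolding col[OF Suc_mono[OF that]] using that a Qs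
    by (auto simp del: sum.lessThan_Suc simp: sum.lessThan_Suc_shift U_def b_def
        if_distrib[where f="\<lambda>u. u * z" for z] cong: if_cong)
  have c00: "?T $$ (0,0) = Q $$ (0,0)"
    unfolding col[OF zero_less_Suc] by (simp del: sum.lessThan_Suc add: sum.lessThan_Suc_shift U_def)
  have "posdef_mat (Suc n) ?T" by (rule posdef_form_act[OF assms U]) (simp add: det)
  from posdef_mat_delete[OF this] have S: "posdef_mat n (mat_delete ?T 0 0)" .
  show ?thesis
    by (rule that[OF U det _ vec _ S]) (use block_sum_eqI[OF T sym c0] c00 in \<open>auto simp: b_def\<close>)
qed

text \<open>If the \<open>k\<close>-th entry of \<open>v\<close> is nonzero, then \<open>v\<close> can replace \<open>e\<^sub>k\<close> in the standard basis; the
columns are arranged so that \<open>v\<close> stands first, which moves \<open>e\<^sub>0\<close> to position \<open>k\<close>.\<close>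

lemma exists_mat_first_col:
  fixes v :: "real vec"
  assumes v: "v \<in> carrier_vec (Suc n)" "v \<noteq> 0\<^sub>v (Suc n)"
  obtains N where "N \<in> carrier_mat (Suc n) (Suc n)" "det N \<noteq> 0" "N *\<^sub>v unit_vec (Suc n) 0 = v"
proof -
  obtain k where k: "k < Suc n" "v $ k \<noteq> 0"
    using v by (metis eq_vecI index_zero_vec carrier_vecD)
  define \<sigma> where "\<sigma> j = (if j = k then 0 else j)" for j
  define N where "N = mat (Suc n) (Suc n) (\<lambda>(i,j). if j = 0 then v $ i else if i = \<sigma> j then 1 else 0)"
  have N: "N \<in> carrier_mat (Suc n) (Suc n)" unfolding N_def by simp
  have Nw: "(N *\<^sub>v w) $ i = v $ i * w $ 0 + (\<Sum>j<n. if i = \<sigma> (Suc j) then w $ Suc j else 0)"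
    if "w \<in> carrier_vec (Suc n)" "i < Suc n" for w i
  proof -
    have "(N *\<^sub>v w) $ i = (\<Sum>j<Suc n. N $$ (i,j) * w $ j)"
      using that N by (auto simp: scalar_prod_def atLeast0LessThan intro!: sum.cong)
    also have "\<dots> = v $ i * w $ 0 + (\<Sum>j<n. if i = \<sigma> (Suc j) then w $ Suc j else 0)"
      unfolding sum.lessThan_Suc_shift using that(2)
      by (auto simp: N_def intro!: arg_cong2[where f="(+)"] sum.cong)
    finally show ?thesis .
  qed
  have "w = 0\<^sub>v (Suc n)" if w: "w \<in> carrier_vec (Suc n)" "N *\<^sub>v w = 0\<^sub>v (Suc n)" for w
  proof -
    have eq: "v $ i * w $ 0 + (\<Sum>j<n. if i = \<sigma> (Suc j) then w $ Suc j else 0) = 0"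
      if "i < Suc n" for i using Nw[OF w(1) that] w(2) that by simp
    have "(\<Sum>j<n. if k = \<sigma> (Suc j) then w $ Suc j else 0) = 0"
      by (intro sum.neutral) (auto simp: \<sigma>_def)
    with eq[OF k(1)] k have w0: "w $ 0 = 0" by simp
    have "w $ Suc j = 0" if j: "j < n" for j
    proof -
      have "\<sigma> (Suc j) < Suc n" using j by (auto simp: \<sigma>_def)
      from eq[OF this] w0
      have "(\<Sum>l<n. if \<sigma> (Suc j) = \<sigma> (Suc l) then w $ Suc l else 0) = 0" by simp
      moreover have "(\<sigma> (Suc j) = \<sigma> (Suc l)) = (j = l)" for l by (auto simp: \<sigma>_def)
      ultimately show ?thesis using j by simp
    qed
    then show ?thesis using w0 w(1)
      by (intro eq_vecI) (auto simp: less_Suc_eq_0_disj)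
  qed
  then have det: "det N \<noteq> 0" using det_0_iff_vec_prod_zero_field[OF N] by auto
  have "N *\<^sub>v unit_vec (Suc n) 0 = v"
  proof (rule eq_vecI)
    fix i assume i: "i < dim_vec v"
    then show "(N *\<^sub>v unit_vec (Suc n) 0) $ i = v $ i"
      using v by (subst Nw) (auto intro!: sum.neutral simp: unit_vec_def)
  qed (use N v in auto)
  with that N det show ?thesis by blast
qed

section \<open>Simultaneous diagonalization\<close>

lemma inverse_mat_exists:
  fixes A :: "'a :: field mat"
  assumes A: "A \<in> carrier_mat n n" "det A \<noteq> 0"
  obtains B where "B \<in> carrier_mat n n" "A * B = 1\<^sub>m n" "B * A = 1\<^sub>m n"
proof -
  have adj: "adj_mat A \<in> carrier_mat n n" "A * adj_mat A = det A \<cdot>\<^sub>m 1\<^sub>m n"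
    using adj_mat[OF A(1)] by auto
  let ?B = "inverse (det A) \<cdot>\<^sub>m adj_mat A"
  have B: "?B \<in> carrier_mat n n" using adj by simp
  have "A * ?B = inverse (det A) \<cdot>\<^sub>m (A * adj_mat A)"
    by (rule mult_smult_distrib[OF A(1) adj(1)])
  also have "\<dots> = 1\<^sub>m n" unfolding adj(2) using A(2) by (intro eq_matI) auto
  finally have AB: "A * ?B = 1\<^sub>m n" .
  show ?thesis by (rule that[OF B AB mat_mult_left_right_inverse[OF A(1) B AB]])
qed

lemma posdef_det_nonzero:
  assumes "posdef_mat n Q"
  shows "det Q \<noteq> 0"
proof
  note Q = posdef_matD[OF assms]
  assume "det Q = 0"
  then obtain v where v: "v \<in> carrier_vec n" "v \<noteq> 0\<^sub>v n" "Q *\<^sub>v v = 0\<^sub>v n"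
    using det_0_iff_vec_prod_zero_field[OF Q(1)] by auto
  then have "qf Q v = 0" unfolding qf_def by simp
  then show False using Q(3)[OF v(1,2)] by simp
qed

lemma symmetric_bilinear:
  fixes S :: "real mat"
  assumes "S \<in> carrier_mat n n" "S\<^sup>T = S" "x \<in> carrier_vec n" "y \<in> carrier_vec n"
  shows "x \<bullet> (S *\<^sub>v y) = y \<bullet> (S *\<^sub>v x)"
  using mult_vec_scalar_prod[OF assms(1,4,3)] assms
  by (simp add: comm_scalar_prod[of "S *\<^sub>v y" n])

text \<open>A complex eigenvector \<open>x + i y\<close> of the inverse of \<open>Q1\<close> times \<open>Q2\<close> exists by the fundamental theorem
of algebra. Symmetry of both forms shows that the imaginary part of the eigenvalue, multiplied by
\<open>Q1(x) + Q1(y) > 0\<close>, vanishes; so the eigenvalue is real and one of \<open>x\<close>, \<open>y\<close> is an eigenvector.\<close>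

lemma generalized_eigenvector:
  assumes Q1: "posdef_mat n Q1" and n: "n > 0"
    and Q2: "Q2 \<in> carrier_mat n n" "Q2\<^sup>T = Q2"
  obtains l v where "v \<in> carrier_vec n" "v \<noteq> 0\<^sub>v n" "Q2 *\<^sub>v v = l \<cdot>\<^sub>v (Q1 *\<^sub>v v)"
proof -
  note P = posdef_matD[OF Q1]
  obtain R where R: "R \<in> carrier_mat n n" "Q1 * R = 1\<^sub>m n"
    using inverse_mat_exists[OF P(1) posdef_det_nonzero[OF Q1]] by metis
  define A where "A = R * Q2"
  have A: "A \<in> carrier_mat n n" unfolding A_def using R Q2 by auto
  have Q1A: "Q1 *\<^sub>v (A *\<^sub>v w) = Q2 *\<^sub>v w" if "w \<in> carrier_vec n" for w
  proof -
    have "Q1 *\<^sub>v (A *\<^sub>v w) = (Q1 * (R * Q2)) *\<^sub>v w"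
      unfolding A_def using R Q2 P that by (subst assoc_mult_mat_vec[of _ n n _ n]) auto
    also have "Q1 * (R * Q2) = Q2"
      using R Q2 P by (subst assoc_mult_mat[of _ n n _ n _ n, symmetric]) auto
    finally show ?thesis .
  qed
  let ?C = "map_mat complex_of_real A"
  have C: "?C \<in> carrier_mat n n" using A by simp
  obtain z v where v: "v \<in> carrier_vec n" "v \<noteq> 0\<^sub>v n" "?C *\<^sub>v v = z \<cdot>\<^sub>v v"
    using spectrum_non_empty[OF C n] C unfolding spectrum_def eigenvalue_def eigenvector_def by auto
  define x where "x = map_vec Re v"
  define y where "y = map_vec Im v"
  have xy: "x \<in> carrier_vec n" "y \<in> carrier_vec n" unfolding x_def y_def using v by auto
  have vi: "(\<Sum>j<n. of_real (A $$ (i,j)) * v $ j) = z * v $ i" if i: "i < n" for i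
  proof -
    have "(?C *\<^sub>v v) $ i = (\<Sum>j<n. of_real (A $$ (i,j)) * v $ j)"
      using i v(1) A by (auto simp: scalar_prod_def atLeast0LessThan intro!: sum.cong)
    then show ?thesis using v i by simp
  qed
  have Ax: "A *\<^sub>v x = Re z \<cdot>\<^sub>v x - Im z \<cdot>\<^sub>v y"
  proof (rule eq_vecI)
    fix i assume "i < dim_vec (Re z \<cdot>\<^sub>v x - Im z \<cdot>\<^sub>v y)"
    then have i: "i < n" using xy by simp
    have "(A *\<^sub>v x) $ i = Re (\<Sum>j<n. of_real (A $$ (i,j)) * v $ j)"
      using i v A by (auto simp: scalar_prod_def atLeast0LessThan x_def intro!: sum.cong)
    then show "(A *\<^sub>v x) $ i = (Re z \<cdot>\<^sub>v x - Im z \<cdot>\<^sub>v y) $ i"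
      using vi[OF i] i v by (simp add: x_def y_def)
  qed (use A xy in auto)
  have Ay: "A *\<^sub>v y = Re z \<cdot>\<^sub>v y + Im z \<cdot>\<^sub>v x"
  proof (rule eq_vecI)
    fix i assume "i < dim_vec (Re z \<cdot>\<^sub>v y + Im z \<cdot>\<^sub>v x)"
    then have i: "i < n" using xy by simp
    have "(A *\<^sub>v y) $ i = Im (\<Sum>j<n. of_real (A $$ (i,j)) * v $ j)"
      using i v A by (auto simp: scalar_prod_def atLeast0LessThan y_def intro!: sum.cong)
    then show "(A *\<^sub>v y) $ i = (Re z \<cdot>\<^sub>v y + Im z \<cdot>\<^sub>v x) $ i"
      using vi[OF i] i v by (simp add: x_def y_def)
  qed (use A xy in auto)
  have Q1c: "Q1 *\<^sub>v x \<in> carrier_vec n" "Q1 *\<^sub>v y \<in> carrier_vec n" using P xy by auto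
  \<comment> \<open>Real and imaginary parts of the eigenvector equation.\<close>
  have Q2x: "Q2 *\<^sub>v x = Re z \<cdot>\<^sub>v (Q1 *\<^sub>v x) - Im z \<cdot>\<^sub>v (Q1 *\<^sub>v y)"
    unfolding Q1A[OF xy(1), symmetric] Ax using P(1) xy
    by (simp add: mult_minus_distrib_mat_vec[of _ n n] mult_mat_vec[of _ n n])
  have Q2y: "Q2 *\<^sub>v y = Re z \<cdot>\<^sub>v (Q1 *\<^sub>v y) + Im z \<cdot>\<^sub>v (Q1 *\<^sub>v x)"
    unfolding Q1A[OF xy(2), symmetric] Ay using P(1) xy
    by (simp add: mult_add_distrib_mat_vec[of _ n n] mult_mat_vec[of _ n n])
  \<comment> \<open>By symmetry the left-hand sides below agree, and so do the terms with factor Re z.\<close>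
  have "y \<bullet> (Q2 *\<^sub>v x) = Re z * (y \<bullet> (Q1 *\<^sub>v x)) - Im z * qf Q1 y"
    unfolding Q2x qf_def using xy Q1c by (simp add: scalar_prod_minus_distrib[of _ n])
  moreover have "x \<bullet> (Q2 *\<^sub>v y) = Re z * (x \<bullet> (Q1 *\<^sub>v y)) + Im z * qf Q1 x"
    unfolding Q2y qf_def using xy Q1c by (simp add: scalar_prod_add_distrib[of _ n])
  ultimately have z0: "Im z * (qf Q1 x + qf Q1 y) = 0"
    using symmetric_bilinear[OF Q2 xy] symmetric_bilinear[OF P(1,2) xy] by (simp add: algebra_simps)
  have ne: "x \<noteq> 0\<^sub>v n \<or> y \<noteq> 0\<^sub>v n"
  proof (rule ccontr)
    assume *: "\<not> ?thesis"
    have "v = 0\<^sub>v n"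
    proof (rule eq_vecI)
      fix i assume i: "i < dim_vec (0\<^sub>v n :: complex vec)"
      then have "x $ i = 0" "y $ i = 0" using * by auto
      then show "v $ i = 0\<^sub>v n $ i" using i v unfolding x_def y_def by (simp add: complex_eq_iff)
    qed (use v in auto)
    then show False using v by simp
  qed
  have nn: "qf Q1 w \<ge> 0" if "w \<in> carrier_vec n" for w
    using P(3)[OF that] P(1) that by (cases "w = 0\<^sub>v n") (auto simp: qf_def)
  have "qf Q1 x + qf Q1 y > 0"
    using ne P(3)[of x] P(3)[of y] nn[of x] nn[of y] xy by fastforce
  then have "Im z = 0" using z0 by simp
  then have "Q2 *\<^sub>v x = Re z \<cdot>\<^sub>v (Q1 *\<^sub>v x)" "Q2 *\<^sub>v y = Re z \<cdot>\<^sub>v (Q1 *\<^sub>v y)"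
    unfolding Q2x Q2y using Q1c by auto
  with that ne xy show ?thesis by blast
qed

text \<open>Induction on the dimension: put a relative eigenvector first and make the remaining basis vectors
\<open>Q1\<close>-orthogonal to it. The eigenvector equation makes them \<open>Q2\<close>-orthogonal to it as well, so both
forms split off their first variable.\<close>

lemma simultaneous_diagonalization:
  assumes "posdef_mat n Q1" "Q2 \<in> carrier_mat n n" "Q2\<^sup>T = Q2"
  shows "\<exists>P \<in> carrier_mat n n. form_act Q1 P = 1\<^sub>m n \<and> diagonal_mat (form_act Q2 P)"
  using assms
proof (induction n arbitrary: Q1 Q2)
  case 0
  then show ?case
    by (intro bexI[of _ "1\<^sub>m 0"]) (auto simp: posdef_mat_def diagonal_mat_def)
next
  case (Suc n)
  note Q1 = posdef_matD[OF Suc.prems(1)] and Q2 = Suc.prems(2,3)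
  obtain l v where v: "v \<in> carrier_vec (Suc n)" "v \<noteq> 0\<^sub>v (Suc n)"
    "Q2 *\<^sub>v v = l \<cdot>\<^sub>v (Q1 *\<^sub>v v)"
    using generalized_eigenvector[OF Suc.prems(1) _ Q2] by blast
  obtain N where N: "N \<in> carrier_mat (Suc n) (Suc n)" "det N \<noteq> 0" "N *\<^sub>v unit_vec (Suc n) 0 = v"
    using exists_mat_first_col[OF v(1,2)] by blast
  let ?G = "form_act Q1 N"
  have G: "posdef_mat (Suc n) ?G" by (rule posdef_form_act[OF Suc.prems(1) N(1,2)])
  obtain U S b where U: "U \<in> carrier_mat (Suc n) (Suc n)" "b \<in> carrier_vec n"
    "\<And>x y. y \<in> carrier_vec n \<Longrightarrow> U *\<^sub>v vCons x y = vCons (x - b \<bullet> y) y"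
    "form_act ?G U = block_sum (?G $$ (0,0)) S" "posdef_mat n S"
    using gauss_step[OF G] by metis
  define a where "a = ?G $$ (0,0)"
  have a: "a > 0" unfolding a_def by (rule posdef_diag_pos[OF G]) simp
  define M where "M = N * U"
  have M: "M \<in> carrier_mat (Suc n) (Suc n)" unfolding M_def using N U by auto
  have S: "S \<in> carrier_mat n n" using posdef_matD[OF U(5)] by simp
  have e0: "unit_vec (Suc n) 0 = vCons 1 (0\<^sub>v n :: real vec)"
    by (rule eq_vecI) (auto simp: unit_vec_def vCons_def split: nat.split)
  have "U *\<^sub>v unit_vec (Suc n) 0 = unit_vec (Suc n) 0"
    unfolding e0 by (subst U(3)) (use U(2) in auto)
  then have Me0: "M *\<^sub>v unit_vec (Suc n) 0 = v"
    unfolding M_def using N U by (subst assoc_mult_mat_vec[of _ "Suc n" "Suc n" _ "Suc n"]) auto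
  have T1: "form_act Q1 M = block_sum a S"
    unfolding M_def using form_act_mult[OF Q1(1) N(1) U(1)] U(4) a_def by simp
  let ?T = "form_act Q2 M"
  have T: "?T \<in> carrier_mat (Suc n) (Suc n)" using Q2 M by auto
  have sym: "?T\<^sup>T = ?T" by (rule form_act_sym[OF Q2 M])
  have Mt: "M\<^sup>T \<in> carrier_mat (Suc n) (Suc n)" using M by simp
  have "?T *\<^sub>v unit_vec (Suc n) 0 = M\<^sup>T *\<^sub>v (Q2 *\<^sub>v v)"
    using form_act_vec[OF Q2(1) M unit_vec_carrier, of 0] unfolding Me0 .
  also have "\<dots> = l \<cdot>\<^sub>v (M\<^sup>T *\<^sub>v (Q1 *\<^sub>v v))"
    unfolding v(3) by (rule mult_mat_vec[OF Mt]) (use Q1 v in auto)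
  also have "M\<^sup>T *\<^sub>v (Q1 *\<^sub>v v) = block_sum a S *\<^sub>v unit_vec (Suc n) 0"
    using form_act_vec[OF Q1(1) M unit_vec_carrier, of 0] unfolding Me0 T1 by simp
  finally have Te0: "?T *\<^sub>v unit_vec (Suc n) 0 = l \<cdot>\<^sub>v (block_sum a S *\<^sub>v unit_vec (Suc n) 0)" .
  have ent: "(A *\<^sub>v unit_vec (Suc n) 0) $ i = A $$ (i,0)"
    if "A \<in> carrier_mat (Suc n) (Suc n)" "i < Suc n" for A :: "real mat" and i
    using that by (auto simp: scalar_prod_def unit_vec_def if_distrib cong: if_cong)
  have "?T $$ (Suc i, 0) = 0" if "i < n" for i
  proof -
    have "?T $$ (Suc i, 0) = (?T *\<^sub>v unit_vec (Suc n) 0) $ Suc i" using ent[OF T] that by simp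
    also have "\<dots> = l * (block_sum a S *\<^sub>v unit_vec (Suc n) 0) $ Suc i"
      unfolding Te0 using block_sum_carrier[OF S, of a] that by simp
    also have "\<dots> = 0" using ent[OF block_sum_carrier[OF S]] that block_sum_index[OF S, of "Suc i" 0] by simp
    finally show ?thesis .
  qed
  from block_sum_eqI[OF T sym this]
  obtain d S2 where T2: "?T = block_sum d S2" and S2d: "S2 = mat_delete ?T 0 0" by blast
  have S2: "S2 \<in> carrier_mat n n" unfolding S2d using mat_delete_carrier[OF T] by simp
  have "block_sum d (S2\<^sup>T) = block_sum d S2" using sym unfolding T2 block_sum_transpose[OF S2] .
  have "S2\<^sup>T = S2"
  proof (rule eq_matI)
    fix i j assume "i < dim_row S2" "j < dim_col S2"
    then have ij: "i < n" "j < n" using S2 by auto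
    from arg_cong[OF \<open>block_sum d (S2\<^sup>T) = block_sum d S2\<close>, of "\<lambda>M. M $$ (Suc i, Suc j)"] ij
    show "S2\<^sup>T $$ (i,j) = S2 $$ (i,j)"
      using block_sum_index[OF S2] block_sum_index[of "S2\<^sup>T" n n] S2 by simp
  qed (use S2 in auto)
  from Suc.IH[OF U(5) S2 this] obtain P where
    P: "P \<in> carrier_mat n n" "form_act S P = 1\<^sub>m n" "diagonal_mat (form_act S2 P)" by blast
  \<comment> \<open>The first basis vector is scaled to \<open>Q1\<close>-length one.\<close>
  define B where "B = block_sum (1 / sqrt a) P"
  have B: "B \<in> carrier_mat (Suc n) (Suc n)" unfolding B_def using P by simp
  have 1: "form_act Q1 (M * B) = 1\<^sub>m (Suc n)"
    using form_act_mult[OF Q1(1) M B] form_act_block_sum[OF S P(1), of a "1 / sqrt a"] a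
    unfolding T1 P(2) by (simp add: block_sum_one flip: B_def)
  have 2: "form_act Q2 (M * B) = block_sum (1 / sqrt a * d * (1 / sqrt a)) (form_act S2 P)"
    using form_act_mult[OF Q2(1) M B] form_act_block_sum[OF S2 P(1), of d "1 / sqrt a"]
    unfolding T2 by (simp flip: B_def)
  have F: "form_act S2 P \<in> carrier_mat n n" using S2 P by simp
  have "diagonal_mat (block_sum e (form_act S2 P))" for e
    unfolding diagonal_mat_def
  proof (intro allI impI)
    fix i j
    assume "i < dim_row (block_sum e (form_act S2 P))" "j < dim_col (block_sum e (form_act S2 P))" "i \<noteq> j"
    then have "i < Suc n" "j < Suc n" "i \<noteq> j" using block_sum_carrier[OF F, of e] by auto
    then show "block_sum e (form_act S2 P) $$ (i,j) = 0"
      using P(3) F unfolding diagonal_mat_def by (subst block_sum_index[OF F]) auto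
  qed
  then have "diagonal_mat (form_act Q2 (M * B))" unfolding 2 .
  with 1 show ?case using M B by (intro bexI[of _ "M * B"]) auto
qed

section \<open>The distance as a function of relative eigenvalues\<close>

lemma sum_list_singletons: "(\<Sum>a\<leftarrow>xs. {#a#}) = mset xs"
  by (induction xs) auto

text \<open>Two \<open>Q1\<close>-orthonormal bases differ by an orthogonal matrix, so the two diagonal matrices are similar
and share their characteristic polynomial, whose roots are the diagonal entries.\<close>

lemma diagonal_entries_unique:
  assumes Q1: "Q1 \<in> carrier_mat n n" and Q2: "Q2 \<in> carrier_mat n n"
    and P: "P \<in> carrier_mat n n" "form_act Q1 P = 1\<^sub>m n" "diagonal_mat (form_act Q2 P)"
    and P': "P' \<in> carrier_mat n n" "form_act Q1 P' = 1\<^sub>m n" "diagonal_mat (form_act Q2 P')"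
  shows "mset (diag_mat (form_act Q2 P)) = mset (diag_mat (form_act Q2 P'))"
proof -
  let ?D = "form_act Q2 P" and ?D' = "form_act Q2 P'"
  have D: "?D \<in> carrier_mat n n" "?D' \<in> carrier_mat n n" using Q2 P P' by auto
  have "det P \<noteq> 0" using det_form_act[OF Q1 P(1)] P(2) by auto
  then obtain R where R: "R \<in> carrier_mat n n" "P * R = 1\<^sub>m n"
    using inverse_mat_exists[OF P(1)] by metis
  define W where "W = R * P'"
  have W: "W \<in> carrier_mat n n" unfolding W_def using R P' by simp
  have PW: "P * W = P'"
    unfolding W_def using R P P' by (subst assoc_mult_mat[of _ n n _ n _ n, symmetric]) auto
  have "form_act (1\<^sub>m n) W = 1\<^sub>m n"
    using form_act_mult[OF Q1 P(1) W] unfolding PW P(2) P'(2) by simp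
  then have WtW: "W\<^sup>T * W = 1\<^sub>m n" unfolding form_act_def using W by simp
  have Wt: "W\<^sup>T \<in> carrier_mat n n" using W by simp
  have WWt: "W * W\<^sup>T = 1\<^sub>m n" by (rule mat_mult_left_right_inverse[OF Wt W WtW])
  have "?D' = W\<^sup>T * ?D * W"
    using form_act_mult[OF Q2 P(1) W] unfolding PW by (simp add: form_act_def)
  then have "similar_mat ?D' ?D"
    by (intro similar_matI[of _ _ "W\<^sup>T" W n]) (use D W Wt WtW WWt in auto)
  then have cp: "char_poly ?D' = char_poly ?D" by (rule char_poly_similar)
  have "proots (char_poly E) = mset (diag_mat E)" if "E \<in> carrier_mat n n" "diagonal_mat E"
    for E :: "real mat"
  proof -
    have "upper_triangular E" using that by (auto simp: upper_triangular_def diagonal_mat_def)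
    from char_poly_upper_triangular[OF that(1) this]
    have "proots (char_poly E) = (\<Sum>a\<leftarrow>diag_mat E. proots [:- a, 1:])"
      using proots_prod_list[of "map (\<lambda>a. [:- a, 1:]) (diag_mat E)"] by (force simp: o_def)
    also have "\<dots> = mset (diag_mat E)" using sum_list_singletons by simp
    finally show ?thesis .
  qed
  then show ?thesis using D P(3) P'(3) cp by metis
qed

text \<open>Any simultaneous diagonalization computes the distance, which makes the definite description in
\<open>form_dist\<close> usable.\<close>

lemma form_dist_eqI:
  assumes Q1: "Q1 \<in> carrier_mat n n" and Q2: "Q2 \<in> carrier_mat n n"
    and P: "P \<in> carrier_mat n n" "form_act Q1 P = 1\<^sub>m n" "form_act Q2 P = mat_diag n d"
  shows "form_dist n Q1 Q2 = sqrt (\<Sum>i<n. (ln (d i))\<^sup>2)"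
proof -
  have diag: "diagonal_mat (form_act Q2 P)" unfolding P(3) by (auto simp: diagonal_mat_def mat_diag_def)
  have sum_eq: "(\<Sum>i<n. (ln (E $$ (i,i)))\<^sup>2) = sum_mset (image_mset (\<lambda>a. (ln a)\<^sup>2) (mset (diag_mat E)))"
    if "E \<in> carrier_mat n n" for E :: "real mat"
  proof -
    have "(\<Sum>i<n. (ln (E $$ (i,i)))\<^sup>2) = sum_list (map (\<lambda>a. (ln a)\<^sup>2) (diag_mat E))"
      using that by (simp add: diag_mat_def o_def sum_list_distinct_conv_sum_set atLeast0LessThan)
    also have "\<dots> = sum_mset (mset (map (\<lambda>a. (ln a)\<^sup>2) (diag_mat E)))"
      by (rule sum_mset_sum_list[symmetric])
    finally show ?thesis by simp
  qed
  show ?thesis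
    unfolding form_dist_def
  proof (rule the_equality)
    show "\<exists>P\<in>carrier_mat n n. form_act Q1 P = 1\<^sub>m n \<and> diagonal_mat (form_act Q2 P) \<and>
        sqrt (\<Sum>i<n. (ln (d i))\<^sup>2) = sqrt (\<Sum>i<n. (ln (form_act Q2 P $$ (i, i)))\<^sup>2)"
      using P diag by (intro bexI[of _ P]) (auto simp: mat_diag_def)
  next
    fix r assume "\<exists>P\<in>carrier_mat n n. form_act Q1 P = 1\<^sub>m n \<and> diagonal_mat (form_act Q2 P) \<and>
        r = sqrt (\<Sum>i<n. (ln (form_act Q2 P $$ (i, i)))\<^sup>2)"
    then obtain P' where P': "P' \<in> carrier_mat n n" "form_act Q1 P' = 1\<^sub>m n"
      "diagonal_mat (form_act Q2 P')" "r = sqrt (\<Sum>i<n. (ln (form_act Q2 P' $$ (i, i)))\<^sup>2)" by blast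
    have "(\<Sum>i<n. (ln (form_act Q2 P' $$ (i, i)))\<^sup>2) = (\<Sum>i<n. (ln (form_act Q2 P $$ (i, i)))\<^sup>2)"
      unfolding sum_eq[OF form_act_carrier[OF Q2 P(1)]] sum_eq[OF form_act_carrier[OF Q2 P'(1)]]
        diagonal_entries_unique[OF Q1 Q2 P(1,2) diag P'(1-3)] ..
    then show "r = sqrt (\<Sum>i<n. (ln (d i))\<^sup>2)"
      unfolding P'(4) by (simp add: P(3) mat_diag_def)
  qed
qed

lemma qf_mat_diag:
  assumes "w \<in> carrier_vec n"
  shows "qf (mat_diag n d) w = (\<Sum>i<n. d i * (w $ i)\<^sup>2)"
  using assms by (subst qf_sum[of _ n])
    (auto simp: mat_diag_def power2_eq_square if_distrib[where f="\<lambda>u. u * z" for z] cong: if_cong)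

lemma qf_one:
  assumes "w \<in> carrier_vec n"
  shows "qf (1\<^sub>m n) w = (\<Sum>i<n. (w $ i)\<^sup>2)"
  using qf_mat_diag[OF assms, of "\<lambda>_. 1"] by simp

lemma relative_diagonalization:
  assumes Q1: "posdef_mat n Q1" and Q2: "posdef_mat n Q2"
  shows "\<exists>P d. P \<in> carrier_mat n n \<and> det P \<noteq> 0 \<and>
    form_act Q1 P = 1\<^sub>m n \<and> form_act Q2 P = mat_diag n d \<and> (\<forall>i<n. d i > 0) \<and>
    form_dist n Q1 Q2 = sqrt (\<Sum>i<n. (ln (d i))\<^sup>2) \<and>
    (det Q1 = det Q2 \<longrightarrow> (\<Sum>i<n. ln (d i)) = 0)"
proof -
  note D1 = posdef_matD[OF Q1] and D2 = posdef_matD[OF Q2]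
  obtain P where P: "P \<in> carrier_mat n n" "form_act Q1 P = 1\<^sub>m n" "diagonal_mat (form_act Q2 P)"
    using simultaneous_diagonalization[OF Q1 D2(1,2)] by blast
  define d where "d i = form_act Q2 P $$ (i,i)" for i
  have E: "form_act Q2 P \<in> carrier_mat n n" using D2 P by simp
  have Pd: "form_act Q2 P = mat_diag n d"
    by (rule eq_matI) (use E P(3) in \<open>auto simp: mat_diag_def d_def diagonal_mat_def\<close>)
  have det1: "det Q1 * (det P)\<^sup>2 = 1" using det_form_act[OF D1(1) P(1)] P(2) by simp
  then have det: "det P \<noteq> 0" by auto
  have pos: "d i > 0" if "i < n" for i
    unfolding d_def by (rule posdef_diag_pos[OF posdef_form_act[OF Q2 P(1) det] that])
  have "(\<Sum>i<n. ln (d i)) = 0" if "det Q1 = det Q2"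
  proof -
    have "det (mat_diag n d) = 1" using det_form_act[OF D2(1) P(1)] det1 that Pd by simp
    moreover have "det (mat_diag n d) = prod_list (diag_mat (mat_diag n d))"
      by (rule det_upper_triangular[of _ n]) (auto simp: mat_diag_def)
    ultimately have "(\<Prod>i<n. d i) = 1"
      unfolding prod_list_diag_prod by (simp add: mat_diag_def atLeast0LessThan)
    moreover have "ln (\<Prod>i<n. d i) = (\<Sum>i<n. ln (d i))"
      by (rule ln_prod, simp) (metis pos lessThan_iff less_irrefl)
    ultimately show ?thesis by simp
  qed
  then show ?thesis
    using P(1) det P(2) Pd pos form_dist_eqI[OF D1(1) D2(1) P(1,2) Pd] by blast
qed

lemma form_dist_nonneg:
  assumes "posdef_mat n Q1" "posdef_mat n Q2"
  shows "form_dist n Q1 Q2 \<ge> 0"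
  using relative_diagonalization[OF assms] by (auto simp: sum_nonneg)

lemma posdef_inverse:
  assumes Q: "posdef_mat n Q" and R: "R \<in> carrier_mat n n" "Q * R = 1\<^sub>m n"
  shows "posdef_mat n R"
proof -
  note D = posdef_matD[OF Q]
  have Rt: "R\<^sup>T \<in> carrier_mat n n" using R by simp
  have "R\<^sup>T * Q = (Q * R)\<^sup>T" using transpose_mult[OF D(1) R(1)] D(2) by simp
  then have RtQ: "R\<^sup>T * Q = 1\<^sub>m n" using R(2) by simp
  have "form_act Q R = R" unfolding form_act_def RtQ using R by simp
  moreover have "det R \<noteq> 0" using det_mult[OF D(1) R(1)] R(2) by auto
  ultimately show ?thesis using posdef_form_act[OF Q R(1)] by simp
qed

text \<open>If \<open>P\<close> diagonalizes \<open>Q1\<close> and \<open>Q2\<close>, then the dual basis, whose matrix is \<open>Q1 * P\<close>, diagonalizes the inverse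
forms, and the relative eigenvalues get inverted; squares of logarithms do not notice.\<close>

lemma form_dist_inverse:
  assumes Q1: "posdef_mat n Q1" and R1: "R1 \<in> carrier_mat n n" "Q1 * R1 = 1\<^sub>m n"
    and Q2: "posdef_mat n Q2" and R2: "R2 \<in> carrier_mat n n" "Q2 * R2 = 1\<^sub>m n"
  shows "form_dist n R1 R2 = form_dist n Q1 Q2"
proof -
  note D1 = posdef_matD[OF Q1] and D2 = posdef_matD[OF Q2]
  note assoc = assoc_mult_mat[of _ n n _ n _ n] and carr = mult_carrier_mat[of _ n n _ n]
  obtain P d where P: "P \<in> carrier_mat n n" "det P \<noteq> 0"
    "form_act Q1 P = 1\<^sub>m n" "form_act Q2 P = mat_diag n d" "\<forall>i<n. d i > 0"
    "form_dist n Q1 Q2 = sqrt (\<Sum>i<n. (ln (d i))\<^sup>2)"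
    using relative_diagonalization[OF Q1 Q2] by blast
  have Pt: "P\<^sup>T \<in> carrier_mat n n" using P(1) by simp
  have PtQP: "P\<^sup>T * (Q1 * P) = 1\<^sub>m n"
    using P(3) assoc[OF Pt D1(1) P(1)] unfolding form_act_def by simp
  have "P\<^sup>T * Q1 * P = 1\<^sub>m n" using P(3) unfolding form_act_def .
  then have PPt: "P * (P\<^sup>T * Q1) = 1\<^sub>m n"
    by (intro mat_mult_left_right_inverse[OF mult_carrier_mat[OF Pt D1(1)] P(1)])
  define B where "B = Q1 * P"
  have B: "B \<in> carrier_mat n n" unfolding B_def using D1(1) P(1) by simp
  have Bt: "B\<^sup>T = P\<^sup>T * Q1" unfolding B_def using transpose_mult[OF D1(1) P(1)] D1(2) by simp
  have R1Q1: "R1 * Q1 = 1\<^sub>m n" by (rule mat_mult_left_right_inverse[OF D1(1) R1])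
  have "R1 * B = (R1 * Q1) * P" unfolding B_def using assoc[OF R1(1) D1(1) P(1)] by simp
  then have "R1 * B = P" using R1Q1 P(1) by simp
  moreover have "form_act R1 B = B\<^sup>T * (R1 * B)"
    unfolding form_act_def using B R1(1) by (intro assoc) auto
  moreover have "B\<^sup>T * P = P\<^sup>T * (Q1 * P)"
    unfolding Bt by (rule assoc[OF Pt D1(1) P(1)])
  ultimately have 1: "form_act R1 B = 1\<^sub>m n" using PtQP by simp
  let ?X = "form_act R2 B"
  have X: "?X \<in> carrier_mat n n" using R2(1) B by simp
  have BX: "?X = B\<^sup>T * (R2 * B)"
    unfolding form_act_def using B R2(1) by (intro assoc) auto
  have "mat_diag n d * ?X = (P\<^sup>T * Q2) * ((P * B\<^sup>T) * (R2 * B))"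
    unfolding BX P(4)[symmetric] unfolding form_act_def Bt
    using P(1) Pt D1(1) D2(1) R2(1) B by (simp add: assoc carr)
  also have "P * B\<^sup>T = 1\<^sub>m n" unfolding Bt by (rule PPt)
  also have "(P\<^sup>T * Q2) * (1\<^sub>m n * (R2 * B)) = P\<^sup>T * ((Q2 * R2) * B)"
    using P(1) Pt D2(1) R2(1) B by (simp add: assoc carr)
  also have "\<dots> = 1\<^sub>m n" unfolding R2(2) left_mult_one_mat[OF B] using PtQP by (simp add: B_def)
  finally have DX: "mat_diag n d * ?X = 1\<^sub>m n" .
  have dn: "d i \<noteq> 0" if "i < n" for i using P(5) that by auto
  have "mat_diag n (\<lambda>i. 1 / d i) * mat_diag n d = 1\<^sub>m n"
    unfolding mat_diag_diag by (rule eq_matI) (auto simp: mat_diag_def dn)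
  then have "?X = (mat_diag n (\<lambda>i. 1 / d i) * mat_diag n d) * ?X" using X by simp
  also have "\<dots> = mat_diag n (\<lambda>i. 1 / d i) * (mat_diag n d * ?X)"
    by (rule assoc) (use X in auto)
  finally have 2: "?X = mat_diag n (\<lambda>i. 1 / d i)" unfolding DX
    by (simp add: right_mult_one_mat[OF mat_diag_dim])
  have "form_dist n R1 R2 = sqrt (\<Sum>i<n. (ln (1 / d i))\<^sup>2)"
    by (rule form_dist_eqI[OF R1(1) R2(1) B 1 2])
  also have "\<dots> = sqrt (\<Sum>i<n. (ln (d i))\<^sup>2)"
    by (intro arg_cong[where f=sqrt] sum.cong) (auto simp: ln_div P(5) dn)
  finally show ?thesis using P(6) by simp
qed

text \<open>Cauchy-Schwarz: the entries other than the \<open>k\<close>-th have sum \<open>- l k\<close>, and their sum of squares is least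
when they are all equal.\<close>

lemma trace_zero_square_bound:
  fixes l :: "nat \<Rightarrow> real"
  assumes s: "s \<ge> 2" and k: "k < s" and sum0: "(\<Sum>i<s. l i) = 0"
  shows "(\<Sum>i<s. (l i)\<^sup>2) \<ge> real s / (real s - 1) * (l k)\<^sup>2"
proof -
  let ?A = "{..<s} - {k}"
  have c: "real (card ?A) = real s - 1" using k s by (simp add: of_nat_diff)
  have sA: "(\<Sum>i\<in>?A. l i) = - l k" using sum.remove[of "{..<s}" k l] k sum0 by simp
  \<comment> \<open>Minus the mean of the other entries; the square of the deviations from the mean is expanded.\<close>
  define m where "m = l k / (real s - 1)"
  have mk: "(real s - 1) * m = l k" unfolding m_def using s by simp
  have "0 \<le> (\<Sum>i\<in>?A. (l i + m)\<^sup>2)" by (rule sum_nonneg) simp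
  also have "\<dots> = (\<Sum>i\<in>?A. (l i)\<^sup>2) + 2 * m * (\<Sum>i\<in>?A. l i) + real (card ?A) * m\<^sup>2"
    by (simp add: power2_sum sum.distrib sum_distrib_left algebra_simps)
  also have "\<dots> = (\<Sum>i\<in>?A. (l i)\<^sup>2) - 2 * m * l k + m * ((real s - 1) * m)"
    unfolding sA c by (simp add: power2_eq_square)
  finally have "(l k)\<^sup>2 / (real s - 1) \<le> (\<Sum>i\<in>?A. (l i)\<^sup>2)"
    unfolding mk by (simp add: m_def power2_eq_square)
  moreover have "(\<Sum>i<s. (l i)\<^sup>2) = (l k)\<^sup>2 + (\<Sum>i\<in>?A. (l i)\<^sup>2)"
    using sum.remove[of "{..<s}" k "\<lambda>i. (l i)\<^sup>2"] k by simp
  moreover have "real s / (real s - 1) * (l k)\<^sup>2 = (l k)\<^sup>2 + (l k)\<^sup>2 / (real s - 1)"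
    using s by (simp add: field_simps)
  ultimately show ?thesis by simp
qed

section \<open>Distance and values of forms\<close>

text \<open>A converse of the previous bound. With a common upper bound \<open>Y\<close>, the defects \<open>Y - l i\<close> for
\<open>i \<noteq> k\<close> are nonnegative and sum to \<open>(s - 1) * Y + l k\<close>. When this sum is small, the entries other
than the \<open>k\<close>-th are nearly equal, and the Cauchy-Schwarz bound is nearly attained.\<close>

lemma trace_zero_square_upper:
  fixes l :: "nat \<Rightarrow> real"
  assumes s: "s \<ge> 2" and k: "k < s" and sum0: "(\<Sum>i<s. l i) = 0"
    and Y: "\<And>i. i < s \<Longrightarrow> l i \<le> Y"
  shows "(\<Sum>i<s. (l i)\<^sup>2) \<le> real s / (real s - 1) * (l k)\<^sup>2 + ((real s - 1) * Y + l k)\<^sup>2"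
    and "(real s - 1) * Y + l k \<ge> 0"
proof -
  let ?A = "{..<s} - {k}"
  have c: "real (card ?A) = real s - 1" using k s by (simp add: of_nat_diff)
  have sA: "(\<Sum>i\<in>?A. l i) = - l k" using sum.remove[of "{..<s}" k l] k sum0 by simp
  define \<beta> where "\<beta> = (\<Sum>i\<in>?A. Y - l i)"
  have \<beta>: "\<beta> = (real s - 1) * Y + l k" unfolding \<beta>_def sum_subtractf sA by (simp add: c)
  show nn: "(real s - 1) * Y + l k \<ge> 0"
    unfolding \<beta>[symmetric] \<beta>_def by (rule sum_nonneg) (use Y in auto)
  have "(\<Sum>i\<in>?A. (Y - l i)\<^sup>2) \<le> (\<Sum>i\<in>?A. (Y - l i) * \<beta>)"
  proof (rule sum_mono)
    fix i assume i: "i \<in> ?A"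
    have "Y - l i \<le> \<beta>" unfolding \<beta>_def
      by (rule member_le_sum[OF i]) (use Y in auto)
    then show "(Y - l i)\<^sup>2 \<le> (Y - l i) * \<beta>"
      unfolding power2_eq_square using i Y by (intro mult_left_mono) auto
  qed
  also have "\<dots> = \<beta>\<^sup>2" unfolding \<beta>_def by (simp add: sum_distrib_right power2_eq_square)
  finally have z: "(\<Sum>i\<in>?A. (Y - l i)\<^sup>2) \<le> \<beta>\<^sup>2" .
  have "(\<Sum>i\<in>?A. (Y - l i)\<^sup>2) = (real s - 1) * Y\<^sup>2 + 2 * Y * l k + (\<Sum>i\<in>?A. (l i)\<^sup>2)"
  proof -
    have "(\<Sum>i\<in>?A. (Y - l i)\<^sup>2) = (\<Sum>i\<in>?A. Y\<^sup>2 - 2 * Y * l i + (l i)\<^sup>2)"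
      by (intro sum.cong) (auto simp: power2_diff)
    also have "\<dots> = (real s - 1) * Y\<^sup>2 - 2 * Y * (\<Sum>i\<in>?A. l i) + (\<Sum>i\<in>?A. (l i)\<^sup>2)"
      using c by (simp add: sum.distrib sum_subtractf flip: sum_distrib_left)
    finally show ?thesis unfolding sA by simp
  qed
  with z have "(\<Sum>i\<in>?A. (l i)\<^sup>2) \<le> \<beta>\<^sup>2 - ((real s - 1) * Y\<^sup>2 + 2 * Y * l k)" by simp
  moreover have "(real s - 1) * Y\<^sup>2 + 2 * Y * l k = \<beta>\<^sup>2 / (real s - 1) - (l k)\<^sup>2 / (real s - 1)"
  proof -
    have "m * Y\<^sup>2 + 2 * Y * l k = (m * Y + l k)\<^sup>2 / m - (l k)\<^sup>2 / m" if "m > 0" for m :: real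
      using that by (simp add: field_simps power2_eq_square)
    from this[of "real s - 1"] show ?thesis unfolding \<beta> using s by simp
  qed
  moreover have "\<beta>\<^sup>2 / (real s - 1) \<ge> 0" using s by simp
  moreover have "(\<Sum>i<s. (l i)\<^sup>2) = (l k)\<^sup>2 + (\<Sum>i\<in>?A. (l i)\<^sup>2)"
    using sum.remove[of "{..<s}" k "\<lambda>i. (l i)\<^sup>2"] k by simp
  moreover have "real s / (real s - 1) * (l k)\<^sup>2 = (l k)\<^sup>2 + (l k)\<^sup>2 / (real s - 1)"
    using s by (simp add: field_simps)
  ultimately show "(\<Sum>i<s. (l i)\<^sup>2) \<le> real s / (real s - 1) * (l k)\<^sup>2 + ((real s - 1) * Y + l k)\<^sup>2"
    unfolding \<beta>[symmetric] by linarith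
qed

lemma posdef_qf_nonneg:
  assumes "posdef_mat n Q" "v \<in> carrier_vec n"
  shows "qf Q v \<ge> 0"
  using posdef_matD[OF assms(1)] assms(2) by (cases "v = 0\<^sub>v n") (force simp: qf_def)+

lemma qf_add:
  assumes Q: "Q \<in> carrier_mat n n" "Q\<^sup>T = Q" and a: "a \<in> carrier_vec n" and b: "b \<in> carrier_vec n"
  shows "qf Q (x \<cdot>\<^sub>v a + b) = x\<^sup>2 * qf Q a + 2 * x * (a \<bullet> (Q *\<^sub>v b)) + qf Q b"
proof -
  have c: "Q *\<^sub>v a \<in> carrier_vec n" "Q *\<^sub>v b \<in> carrier_vec n" using Q a b by auto
  have e: "Q *\<^sub>v (x \<cdot>\<^sub>v a + b) = x \<cdot>\<^sub>v (Q *\<^sub>v a) + Q *\<^sub>v b"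
    using Q(1) a b by (simp add: mult_add_distrib_mat_vec[of _ n n] mult_mat_vec[of _ n n])
  have "qf Q (x \<cdot>\<^sub>v a + b) = x * (x * (a \<bullet> (Q *\<^sub>v a))) + x * (a \<bullet> (Q *\<^sub>v b))
     + (x * (b \<bullet> (Q *\<^sub>v a)) + b \<bullet> (Q *\<^sub>v b))"
    unfolding qf_def e using a b c
    by (simp add: add_scalar_prod_distrib[of _ n] scalar_prod_add_distrib[of _ n])
  then show ?thesis
    using symmetric_bilinear[OF Q b a] by (simp add: qf_def power2_eq_square algebra_simps)
qed

text \<open>The mixed term is absorbed with weights, from \<open>Q(\<delta> x a - b) \<ge> 0\<close>. The factor in front of \<open>Q(a)\<close> is
as close to one as desired, which is needed for the exact value of the limit.\<close>

lemma posdef_qf_split: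
  assumes Q: "posdef_mat n Q" and a: "a \<in> carrier_vec n" and b: "b \<in> carrier_vec n" and \<delta>: "\<delta> > 0"
  shows "qf Q (x \<cdot>\<^sub>v a + b) \<le> (1 + \<delta>) * x\<^sup>2 * qf Q a + (1 + 1 / \<delta>) * qf Q b"
proof -
  note D = posdef_matD[OF Q]
  let ?B = "x * (a \<bullet> (Q *\<^sub>v b))"
  have "0 \<le> qf Q ((- \<delta> * x) \<cdot>\<^sub>v a + b)" by (rule posdef_qf_nonneg[OF Q]) (use a b in auto)
  also have "\<dots> = \<delta> * (\<delta> * x\<^sup>2 * qf Q a - 2 * ?B + qf Q b / \<delta>)"
    unfolding qf_add[OF D(1,2) a b] using \<delta> by (simp add: power2_eq_square field_simps)
  finally have "0 \<le> \<delta> * x\<^sup>2 * qf Q a - 2 * ?B + qf Q b / \<delta>"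
    using \<delta> by (simp add: zero_le_mult_iff)
  then show ?thesis unfolding qf_add[OF D(1,2) a b] by (simp add: field_simps)
qed

lemma qf_le_norm:
  assumes A: "A \<in> carrier_mat n n"
  obtains M where "M > 0" "\<And>v. v \<in> carrier_vec n \<Longrightarrow> qf A v \<le> M * qf (1\<^sub>m n) v"
proof
  \<comment> \<open>The summand one makes the constant positive.\<close>
  let ?M = "(\<Sum>i<n. \<Sum>j<n. \<bar>A $$ (i,j)\<bar>) + 1"
  show "?M > 0" by (simp add: sum_nonneg add_nonneg_pos)
  fix v :: "real vec" assume v: "v \<in> carrier_vec n"
  let ?N = "qf (1\<^sub>m n) v"
  have N: "(v $ i)\<^sup>2 \<le> ?N" if "i < n" for i
    unfolding qf_one[OF v] by (rule member_le_sum) (use that in auto)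
  have N0: "?N \<ge> 0" unfolding qf_one[OF v] by (rule sum_nonneg) simp
  have "qf A v \<le> (\<Sum>i<n. \<Sum>j<n. \<bar>A $$ (i,j)\<bar> * ?N)"
    unfolding qf_sum[OF A v]
  proof (intro sum_mono)
    fix i j assume ij: "i \<in> {..<n}" "j \<in> {..<n}"
    have "0 \<le> (\<bar>v $ i\<bar> - \<bar>v $ j\<bar>)\<^sup>2" by simp
    then have "\<bar>v $ i * v $ j\<bar> \<le> ((v $ i)\<^sup>2 + (v $ j)\<^sup>2) / 2"
      by (simp add: power2_diff abs_mult)
    also have "\<dots> \<le> ?N" using N[of i] N[of j] ij by simp
    finally have "\<bar>A $$ (i,j)\<bar> * \<bar>v $ i * v $ j\<bar> \<le> \<bar>A $$ (i,j)\<bar> * ?N"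
      by (intro mult_left_mono) auto
    then show "A $$ (i,j) * (v $ i * v $ j) \<le> \<bar>A $$ (i,j)\<bar> * ?N"
      by (metis abs_ge_self abs_mult order_trans)
  qed
  also have "\<dots> = (\<Sum>i<n. \<Sum>j<n. \<bar>A $$ (i,j)\<bar>) * ?N" by (simp add: sum_distrib_right)
  also have "\<dots> \<le> ?M * ?N" using N0 by (simp add: distrib_right)
  finally show "qf A v \<le> ?M * ?N" .
qed

lemma det_nonzero_preimage:
  fixes P :: "'a :: field mat"
  assumes P: "P \<in> carrier_mat n n" "det P \<noteq> 0" and v: "v \<in> carrier_vec n"
  obtains w where "w \<in> carrier_vec n" "P *\<^sub>v w = v"
proof -
  obtain R where R: "R \<in> carrier_mat n n" "P * R = 1\<^sub>m n" using inverse_mat_exists[OF P] by metis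
  have "P *\<^sub>v (R *\<^sub>v v) = v"
    using assoc_mult_mat_vec[OF P(1) R(1) v] R(2) v by simp
  then show ?thesis using that[of "R *\<^sub>v v"] R v by simp
qed

lemma posdef_qf_ge_norm:
  assumes Q: "posdef_mat n Q"
  obtains K where "K > 0" "\<And>v. v \<in> carrier_vec n \<Longrightarrow> qf (1\<^sub>m n) v \<le> K * qf Q v"
proof -
  note D = posdef_matD[OF Q]
  obtain P d where P: "P \<in> carrier_mat n n" "det P \<noteq> 0" "form_act Q P = 1\<^sub>m n"
    using relative_diagonalization[OF Q Q] by blast
  have PP: "form_act (1\<^sub>m n) P \<in> carrier_mat n n"
    by (rule form_act_carrier[OF one_carrier_mat P(1)])
  obtain M where M: "M > 0" "\<And>v. v \<in> carrier_vec n \<Longrightarrow> qf (form_act (1\<^sub>m n) P) v \<le> M * qf (1\<^sub>m n) v"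
    using qf_le_norm[OF PP] by blast
  show ?thesis
  proof (rule that[OF M(1)])
    fix v :: "real vec" assume "v \<in> carrier_vec n"
    then obtain w where w: "w \<in> carrier_vec n" "P *\<^sub>v w = v"
      using det_nonzero_preimage[OF P(1,2)] by blast
    have "qf (1\<^sub>m n) v = qf (form_act (1\<^sub>m n) P) w"
      using qf_form_act[OF one_carrier_mat P(1) w(1)] w(2) by simp
    also have "\<dots> \<le> M * qf (form_act Q P) w" using M(2)[OF w(1)] P(3) by simp
    also have "qf (form_act Q P) w = qf Q v" using qf_form_act[OF D(1) P(1) w(1)] w(2) by simp
    finally show "qf (1\<^sub>m n) v \<le> M * qf Q v" .
  qed
qed

text \<open>The least eigenvalue of \<open>Q2\<close> relative to \<open>Q1\<close> is at most \<open>Q2(v) / Q1(v)\<close>, and the logarithms of the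
eigenvalues have sum zero because the determinants agree.\<close>

lemma form_dist_lower_bound:
  assumes s: "s \<ge> 2" and Q1: "posdef_mat s Q1" and Q2: "posdef_mat s Q2" and det: "det Q1 = det Q2"
    and v: "v \<in> carrier_vec s" "v \<noteq> 0\<^sub>v s"
  shows "sqrt (real s / (real s - 1)) * (ln (qf Q1 v) - ln (qf Q2 v)) \<le> form_dist s Q1 Q2"
proof -
  note D1 = posdef_matD[OF Q1] and D2 = posdef_matD[OF Q2]
  obtain P d where P: "P \<in> carrier_mat s s" "det P \<noteq> 0"
    "form_act Q1 P = 1\<^sub>m s" "form_act Q2 P = mat_diag s d" "\<forall>i<s. d i > 0"
    "form_dist s Q1 Q2 = sqrt (\<Sum>i<s. (ln (d i))\<^sup>2)" "(\<Sum>i<s. ln (d i)) = 0"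
    using relative_diagonalization[OF Q1 Q2] det by blast
  obtain w where w: "w \<in> carrier_vec s" "P *\<^sub>v w = v"
    using det_nonzero_preimage[OF P(1,2) v(1)] by blast
  have q1: "qf Q1 v = (\<Sum>i<s. (w $ i)\<^sup>2)"
    using qf_form_act[OF D1(1) P(1) w(1)] w P(3) qf_one by simp
  have q2: "qf Q2 v = (\<Sum>i<s. d i * (w $ i)\<^sup>2)"
    using qf_form_act[OF D2(1) P(1) w(1)] w P(4) qf_mat_diag by simp
  obtain k where k: "k < s" "\<And>i. i < s \<Longrightarrow> d k \<le> d i"
    using arg_min_if_finite[of "{..<s}" d] s
    by (metis finite_lessThan lessThan_iff lessThan_empty_iff not_numeral_le_zero linorder_not_less)
  have "d k * qf Q1 v \<le> qf Q2 v" unfolding q1 q2 sum_distrib_left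
    by (intro sum_mono mult_right_mono) (use k in auto)
  moreover have "d k > 0" using P(5) k by simp
  moreover have "qf Q1 v > 0" "qf Q2 v > 0" using D1(3) D2(3) v by auto
  ultimately have "ln (d k) + ln (qf Q1 v) \<le> ln (qf Q2 v)"
    by (metis ln_mult_pos ln_le_cancel_iff mult_pos_pos)
  then have "ln (qf Q1 v) - ln (qf Q2 v) \<le> \<bar>ln (d k)\<bar>" by linarith
  then have "sqrt (real s / (real s - 1)) * (ln (qf Q1 v) - ln (qf Q2 v))
      \<le> sqrt (real s / (real s - 1)) * \<bar>ln (d k)\<bar>"
    by (intro mult_left_mono) (use s in auto)
  also have "\<dots> = sqrt (real s / (real s - 1) * (ln (d k))\<^sup>2)"
    by (subst real_sqrt_mult) simp
  also have "\<dots> \<le> form_dist s Q1 Q2"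
    unfolding P(6) by (intro real_sqrt_le_mono trace_zero_square_bound[OF s k(1) P(7)])
  finally show ?thesis .
qed

section \<open>Rays that contract one axis\<close>

lemma posdef_mat_diag:
  assumes "\<And>i. i < n \<Longrightarrow> d i > 0"
  shows "posdef_mat n (mat_diag n d)"
proof (rule posdef_matI)
  show "(mat_diag n d)\<^sup>T = mat_diag n d" by (rule eq_matI) (auto simp: mat_diag_def)
  fix v :: "real vec" assume v: "v \<in> carrier_vec n" "v \<noteq> 0\<^sub>v n"
  then obtain k where k: "k < n" "v $ k \<noteq> 0"
    by (metis eq_vecI index_zero_vec carrier_vecD)
  have "0 < d k * (v $ k)\<^sup>2" using k assms by simp
  also have "\<dots> \<le> (\<Sum>i<n. d i * (v $ i)\<^sup>2)"
    by (rule member_le_sum) (use k assms in \<open>auto simp: less_imp_le\<close>)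
  finally show "qf (mat_diag n d) v > 0" unfolding qf_mat_diag[OF v(1)] .
qed simp

lemma det_mat_diag:
  fixes d :: "nat \<Rightarrow> real"
  shows "det (mat_diag n d) = (\<Prod>i<n. d i)"
  by (subst det_upper_triangular[of _ n])
     (auto simp: mat_diag_def prod_list_diag_prod atLeast0LessThan)

text \<open>The unit speed geodesic ray in the diagonal forms that contracts the \<open>k\<close>-th axis. The first ray of
the problem has \<open>k = s - 1\<close>; the inverse of the last one has \<open>k = 0\<close>.\<close>

definition contracting_ray :: "nat \<Rightarrow> nat \<Rightarrow> real \<Rightarrow> real mat" where
  "contracting_ray s k t = mat_diag s (\<lambda>j.
     if j = k then exp (- (sqrt ((real s - 1) / real s) * t))
     else exp (t / sqrt (real s * (real s - 1))))"

lemma posdef_contracting_ray: "posdef_mat s (contracting_ray s k t)"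
  unfolding contracting_ray_def by (rule posdef_mat_diag) auto

lemma contracting_ray_speed:
  assumes "s \<ge> 2"
  shows "sqrt ((real s - 1) / real s) = (real s - 1) / sqrt (real s * (real s - 1))"
    and "sqrt (real s / (real s - 1)) * sqrt ((real s - 1) / real s) = 1"
proof -
  have "u * u / (v * u) = u / v" if "u \<noteq> 0" for u v :: real using that by simp
  from this[of "sqrt (real s - 1)" "sqrt (real s)"] assms
  show "sqrt ((real s - 1) / real s) = (real s - 1) / sqrt (real s * (real s - 1))"
    by (simp add: real_sqrt_divide real_sqrt_mult)
  show "sqrt (real s / (real s - 1)) * sqrt ((real s - 1) / real s) = 1"
    using assms by (simp flip: real_sqrt_mult)
qed

lemma det_contracting_ray:
  assumes s: "s \<ge> 2" and k: "k < s"
  shows "det (contracting_ray s k t) = 1"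
proof -
  let ?\<mu> = "sqrt ((real s - 1) / real s)" and ?a = "sqrt (real s * (real s - 1))"
  have "det (contracting_ray s k t) = exp (- (?\<mu> * t)) * (\<Prod>i\<in>{..<s}-{k}. exp (t / ?a))"
    unfolding contracting_ray_def det_mat_diag using k
    by (subst prod.remove[of _ k]) (auto intro!: prod.cong)
  also have "\<dots> = exp (- (?\<mu> * t)) * exp (real (s - 1) * (t / ?a))"
    using k by (simp flip: exp_of_nat_mult)
  also have "\<dots> = exp (- (?\<mu> * t) + (real s - 1) * (t / ?a))"
    unfolding exp_add using s by (simp add: of_nat_diff)
  also have "- (?\<mu> * t) + (real s - 1) * (t / ?a) = 0"
    unfolding contracting_ray_speed(1)[OF s] by simp
  finally show ?thesis by simp
qed

lemma qf_contracting_ray_unit: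
  assumes "k < s"
  shows "qf (contracting_ray s k t) (unit_vec s k) = exp (- (sqrt ((real s - 1) / real s) * t))"
  using assms unfolding contracting_ray_def by (subst qf_unit[of _ s]) (auto simp: mat_diag_def)

lemma eventually_exp_ge:
  fixes a C :: real
  assumes "a > 0"
  shows "eventually (\<lambda>t. C \<le> exp (a * t)) at_top"
proof -
  have "filterlim (\<lambda>t. exp (a * t)) at_top at_top"
    by (intro filterlim_compose[OF exp_at_top] filterlim_tendsto_pos_mult_at_top[OF tendsto_const]
        assms filterlim_ident)
  then show ?thesis by (simp add: filterlim_at_top)
qed

text \<open>An asymptotically sharp lower bound for the eigenvalues of the ray relative to \<open>Q\<close>. Only the
contracted axis matters for large \<open>t\<close>: on the complementary coordinates the ray expands,
and eventually dominates any fixed multiple of the norm after multiplication by \<open>exp (\<mu> t)\<close>.\<close>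

lemma form_le_contracting_ray:
  assumes s: "s \<ge> 2" and Q: "posdef_mat s Q" and k: "k < s" and \<delta>: "\<delta> > 0"
  shows "eventually (\<lambda>t. \<forall>v\<in>carrier_vec s. qf Q v \<le>
    (1 + \<delta>) * Q $$ (k,k) * exp (sqrt ((real s - 1) / real s) * t) * qf (contracting_ray s k t) v) at_top"
proof -
  note D = posdef_matD[OF Q]
  have Qkk: "Q $$ (k,k) > 0" by (rule posdef_diag_pos[OF Q k])
  obtain M where M: "M > 0" "\<And>v. v \<in> carrier_vec s \<Longrightarrow> qf Q v \<le> M * qf (1\<^sub>m s) v"
    using qf_le_norm[OF D(1)] by blast
  define \<mu> where "\<mu> = sqrt ((real s - 1) / real s)"
  have \<mu>: "\<mu> > 0" unfolding \<mu>_def using s by simp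
  have "eventually (\<lambda>t. (1 + 1 / \<delta>) * M / ((1 + \<delta>) * Q $$ (k,k)) \<le> exp (\<mu> * t)) at_top"
    by (rule eventually_exp_ge[OF \<mu>])
  moreover have "eventually (\<lambda>t::real. t \<ge> 0) at_top" by (rule eventually_ge_at_top)
  ultimately show ?thesis
  proof eventually_elim
    fix t :: real
    assume t1: "(1 + 1 / \<delta>) * M / ((1 + \<delta>) * Q $$ (k,k)) \<le> exp (\<mu> * t)" and t0: "t \<ge> 0"
    have big: "(1 + 1 / \<delta>) * M \<le> (1 + \<delta>) * Q $$ (k,k) * exp (\<mu> * t)"
      using t1 Qkk \<delta> by (simp add: pos_divide_le_eq mult.commute)
    let ?A = "{..<s} - {k}"
    show "\<forall>v\<in>carrier_vec s. qf Q v \<le>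
      (1 + \<delta>) * Q $$ (k,k) * exp (sqrt ((real s - 1) / real s) * t) * qf (contracting_ray s k t) v"
    proof
      fix v :: "real vec" assume v: "v \<in> carrier_vec s"
      define w where "w = vec s (\<lambda>i. if i = k then 0 else v $ i)"
      have w: "w \<in> carrier_vec s" unfolding w_def by simp
      have vw: "v = v $ k \<cdot>\<^sub>v unit_vec s k + w"
        by (rule eq_vecI) (use v k in \<open>auto simp: w_def unit_vec_def\<close>)
      define N where "N = qf (1\<^sub>m s) w"
      have N: "N = (\<Sum>i\<in>?A. (v $ i)\<^sup>2)"
        unfolding N_def qf_one[OF w] using k
        by (subst sum.remove[of _ k]) (auto simp: w_def intro!: sum.cong)
      have N0: "N \<ge> 0" unfolding N by (rule sum_nonneg) simp
      have e1: "exp (t / sqrt (real s * (real s - 1))) \<ge> 1" using t0 s by simp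
      have "qf (contracting_ray s k t) v = exp (- (\<mu> * t)) * (v $ k)\<^sup>2 +
          (\<Sum>i\<in>?A. exp (t / sqrt (real s * (real s - 1))) * (v $ i)\<^sup>2)"
        unfolding contracting_ray_def qf_mat_diag[OF v] \<mu>_def using k
        by (subst sum.remove[of _ k]) (auto intro!: sum.cong)
      also have "\<dots> \<ge> exp (- (\<mu> * t)) * (v $ k)\<^sup>2 + N"
        unfolding N using e1 mult_right_mono[OF e1] by (intro add_left_mono sum_mono) fastforce
      finally have R: "exp (- (\<mu> * t)) * (v $ k)\<^sup>2 + N \<le> qf (contracting_ray s k t) v" .
      have "qf Q v \<le> (1 + \<delta>) * (v $ k)\<^sup>2 * qf Q (unit_vec s k) + (1 + 1 / \<delta>) * qf Q w"
        using posdef_qf_split[OF Q unit_vec_carrier w \<delta>, of "v $ k" k] vw by simp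
      also have "qf Q (unit_vec s k) = Q $$ (k,k)" by (rule qf_unit[OF D(1) k])
      also have "(1 + 1 / \<delta>) * qf Q w \<le> (1 + 1 / \<delta>) * (M * N)"
        unfolding N_def by (intro mult_left_mono M(2)[OF w]) (use \<delta> in simp)
      also have "\<dots> \<le> (1 + \<delta>) * Q $$ (k,k) * exp (\<mu> * t) * N"
        using mult_right_mono[OF big N0] by (simp add: mult.assoc)
      also have "(1 + \<delta>) * (v $ k)\<^sup>2 * Q $$ (k,k) + (1 + \<delta>) * Q $$ (k,k) * exp (\<mu> * t) * N
          = (1 + \<delta>) * Q $$ (k,k) * exp (\<mu> * t) * (exp (- (\<mu> * t)) * (v $ k)\<^sup>2 + N)"
      proof -
        have "c * V * q + c * q * E * N = c * q * E * (E' * V + N)" if "E * E' = 1" for c V q E E' :: real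
        proof -
          have "c * q * E * (E' * V + N) = c * q * (E * E') * V + c * q * E * N"
            by (simp add: algebra_simps)
          then show ?thesis using that by simp
        qed
        moreover have "exp (\<mu> * t) * exp (- (\<mu> * t)) = 1" by (simp flip: exp_add)
        ultimately show ?thesis by blast
      qed
      also have "\<dots> \<le> (1 + \<delta>) * Q $$ (k,k) * exp (\<mu> * t) * qf (contracting_ray s k t) v"
        by (rule mult_left_mono[OF R]) (use Qkk \<delta> in simp)
      finally show "qf Q v \<le> (1 + \<delta>) * Q $$ (k,k) * exp (sqrt ((real s - 1) / real s) * t)
          * qf (contracting_ray s k t) v"
        by (simp add: \<mu>_def)
    qed
  qed
qed

text \<open>The least relative eigenvalue is about \<open>exp (- \<mu> t) / Q(e\<^sub>k)\<close>, and every eigenvalue is at most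
\<open>K * exp (t / a)\<close> with \<open>K\<close> independent of \<open>t\<close>. As the logarithms have sum zero and
\<open>\<mu> = (s - 1) / a\<close>, the defects in \<open>trace_zero_square_upper\<close> remain bounded, and a bounded summand
under the square root disappears in the limit.\<close>

lemma form_dist_contracting_ray_upper:
  assumes s: "s \<ge> 2" and Q: "posdef_mat s Q" and det: "det Q = 1" and k: "k < s" and \<epsilon>: "\<epsilon> > 0"
  shows "eventually (\<lambda>t. form_dist s Q (contracting_ray s k t) - t
    \<le> sqrt (real s / (real s - 1)) * ln (Q $$ (k,k)) + \<epsilon>) at_top"
proof -
  note D = posdef_matD[OF Q]
  have Qkk: "Q $$ (k,k) > 0" by (rule posdef_diag_pos[OF Q k])
  define \<mu> where "\<mu> = sqrt ((real s - 1) / real s)"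
  define c where "c = sqrt (real s / (real s - 1))"
  define a where "a = sqrt (real s * (real s - 1))"
  have c: "c > 0" and a: "a > 0" unfolding c_def a_def using s by auto
  have c\<mu>: "c * \<mu> = 1" unfolding c_def \<mu>_def by (rule contracting_ray_speed(2)[OF s])
  have \<mu>a: "\<mu> = (real s - 1) / a" unfolding a_def \<mu>_def by (rule contracting_ray_speed(1)[OF s])
  obtain K where K: "K > 0" "\<And>v. v \<in> carrier_vec s \<Longrightarrow> qf (1\<^sub>m s) v \<le> K * qf Q v"
    using posdef_qf_ge_norm[OF Q] by blast
  define q where "q = ln (Q $$ (k,k))"
  \<comment> \<open>Half of \<open>\<epsilon>\<close> pays for the factor \<open>1 + \<delta>\<close>, the other half for the bounded summand \<open>B\<^sup>2\<close> under the root.\<close>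
  define \<delta> where "\<delta> = exp (\<epsilon> / (2 * c)) - 1"
  have \<delta>: "\<delta> > 0" unfolding \<delta>_def using \<epsilon> c by simp
  have ln\<delta>: "c * ln (1 + \<delta>) = \<epsilon> / 2" unfolding \<delta>_def using c by simp
  \<comment> \<open>A bound for the sum of the defects, independent of \<open>t\<close>.\<close>
  define B where "B = \<bar>(real s - 1) * ln K - q\<bar>"
  \<comment> \<open>From this time on, \<open>t + c * q\<close> is nonnegative and \<open>B\<^sup>2 \<le> \<epsilon> * (t + c * q)\<close>.\<close>
  define T where "T = \<bar>c * q\<bar> + B\<^sup>2 / \<epsilon> + 1"
  have "eventually (\<lambda>t::real. t \<ge> T) at_top" by (rule eventually_ge_at_top)
  with form_le_contracting_ray[OF s Q k \<delta>] show ?thesis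
  proof eventually_elim
    fix t :: real
    let ?R = "contracting_ray s k t"
    assume cmp: "\<forall>v\<in>carrier_vec s. qf Q v \<le>
      (1 + \<delta>) * Q $$ (k,k) * exp (sqrt ((real s - 1) / real s) * t) * qf ?R v" and t: "t \<ge> T"
    have "B\<^sup>2 / \<epsilon> \<ge> 0" using \<epsilon> by simp
    then have t0: "t \<ge> 0" using t unfolding T_def by linarith
    have R: "posdef_mat s ?R" by (rule posdef_contracting_ray)
    note DR = posdef_matD[OF R]
    have detR: "det Q = det ?R" unfolding det det_contracting_ray[OF s k] ..
    obtain P d where P: "P \<in> carrier_mat s s" "det P \<noteq> 0"
      "form_act Q P = 1\<^sub>m s" "form_act ?R P = mat_diag s d" "\<forall>i<s. d i > 0"
      "form_dist s Q ?R = sqrt (\<Sum>i<s. (ln (d i))\<^sup>2)" "(\<Sum>i<s. ln (d i)) = 0"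
      using relative_diagonalization[OF Q R] detR by blast
    have PQ: "qf Q (P *\<^sub>v w) = (\<Sum>i<s. (w $ i)\<^sup>2)" if "w \<in> carrier_vec s" for w
      using qf_form_act[OF D(1) P(1) that] P(3) qf_one[OF that] by simp
    have PR: "qf ?R (P *\<^sub>v w) = (\<Sum>i<s. d i * (w $ i)\<^sup>2)" if "w \<in> carrier_vec s" for w
      using qf_form_act[OF DR(1) P(1) that] P(4) qf_mat_diag[OF that] by simp
    have ei: "qf Q (P *\<^sub>v unit_vec s i) = 1" "qf ?R (P *\<^sub>v unit_vec s i) = d i"
      "P *\<^sub>v unit_vec s i \<in> carrier_vec s" if "i < s" for i
    proof -
      show "qf Q (P *\<^sub>v unit_vec s i) = 1"
        using qf_form_act[OF D(1) P(1) unit_vec_carrier, of i] P(3) qf_unit[of "1\<^sub>m s" s i] that by simp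
      show "qf ?R (P *\<^sub>v unit_vec s i) = d i"
        using qf_form_act[OF DR(1) P(1) unit_vec_carrier, of i] P(4) qf_unit[of "mat_diag s d" s i] that
        by (simp add: mat_diag_def)
    qed (use P(1) in auto)
    have up: "ln (d i) \<le> t / a + ln K" if i: "i < s" for i
    proof -
      have "?R = mat_diag s (\<lambda>j. if j = k then exp (- (\<mu> * t)) else exp (t / a))"
        unfolding contracting_ray_def \<mu>_def a_def ..
      then have "d i \<le> exp (t / a) * qf (1\<^sub>m s) (P *\<^sub>v unit_vec s i)"
        unfolding ei(2)[OF i, symmetric] qf_one[OF ei(3)[OF i]] sum_distrib_left
        using t0 a \<mu>a s
        by (auto simp: qf_mat_diag[OF ei(3)[OF i]] intro!: sum_mono mult_right_mono)
           (simp add: order_trans[of _ 0])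
      also have "\<dots> \<le> exp (t / a) * (K * 1)"
        using K(2)[OF ei(3)[OF i]] unfolding ei(1)[OF i] by (intro mult_left_mono) auto
      finally have "d i \<le> exp (t / a) * K" by simp
      then have "ln (d i) \<le> ln (exp (t / a) * K)" using P(5) i K(1) by (subst ln_le_cancel_iff) auto
      also have "\<dots> = t / a + ln K" using K(1) by (simp add: ln_mult)
      finally show ?thesis .
    qed
    have low: "- (\<mu> * t + q + ln (1 + \<delta>)) \<le> ln (d i)" if i: "i < s" for i
    proof -
      have "1 \<le> (1 + \<delta>) * Q $$ (k,k) * exp (\<mu> * t) * d i"
        using cmp ei[OF i] unfolding \<mu>_def by metis
      then have "0 \<le> ln ((1 + \<delta>) * Q $$ (k,k) * exp (\<mu> * t) * d i)" by (rule ln_ge_zero)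
      also have "\<dots> = ln (1 + \<delta>) + q + \<mu> * t + ln (d i)"
        using Qkk \<delta> P(5)[rule_format, OF i] unfolding q_def by (simp add: ln_mult)
      finally show ?thesis by simp
    qed
    obtain m where m: "m < s" "\<And>i. i < s \<Longrightarrow> d m \<le> d i"
      using arg_min_if_finite[of "{..<s}" d] s
      by (metis finite_lessThan lessThan_iff lessThan_empty_iff not_numeral_le_zero linorder_not_less)
    \<comment> \<open>The least eigenvalue is tested at the contracted axis.\<close>
    have dm: "ln (d m) \<le> - (\<mu> * t + q)"
    proof -
      obtain w where w: "w \<in> carrier_vec s" "P *\<^sub>v w = unit_vec s k"
        using det_nonzero_preimage[OF P(1,2) unit_vec_carrier] by blast
      have "d m * Q $$ (k,k) = d m * (\<Sum>i<s. (w $ i)\<^sup>2)"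
        using PQ[OF w(1)] qf_unit[OF D(1) k] unfolding w(2) by simp
      also have "\<dots> \<le> (\<Sum>i<s. d i * (w $ i)\<^sup>2)" unfolding sum_distrib_left
        by (intro sum_mono mult_right_mono) (use m in auto)
      also have "\<dots> = exp (- (\<mu> * t))"
        using PR[OF w(1)] qf_contracting_ray_unit[OF k, of t] unfolding w(2) \<mu>_def by simp
      finally have "ln (d m * Q $$ (k,k)) \<le> ln (exp (- (\<mu> * t)))"
        using P(5) m Qkk by (subst ln_le_cancel_iff) auto
      then show ?thesis using P(5)[rule_format, OF m(1)] Qkk unfolding q_def by (simp add: ln_mult)
    qed
    define x where "x = - ln (d m)"
    define \<beta> where "\<beta> = (real s - 1) * (t / a + ln K) + ln (d m)"
    note sq = trace_zero_square_upper[OF s m(1) P(7) up]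
    have \<beta>0: "\<beta> \<ge> 0" unfolding \<beta>_def by (rule sq(2))
    have "\<beta> \<le> (real s - 1) * ln K - q" unfolding \<beta>_def using dm \<mu>a by (simp add: field_simps)
    then have \<beta>B: "\<beta>\<^sup>2 \<le> B\<^sup>2" using \<beta>0 unfolding B_def by (intro power_mono) auto
    define z where "z = t + c * q + \<epsilon> / 2"
    have "c * x \<le> c * (\<mu> * t + q + ln (1 + \<delta>))"
      unfolding x_def using low[OF m(1)] c by (intro mult_left_mono) auto
    also have "\<dots> = (c * \<mu>) * t + c * q + c * ln (1 + \<delta>)" by (simp add: algebra_simps)
    also have "\<dots> = z" unfolding c\<mu> ln\<delta> z_def by simp
    finally have cx: "c * x \<le> z" .
    have "0 \<le> t + c * q" using t \<open>B\<^sup>2 / \<epsilon> \<ge> 0\<close> unfolding T_def by linarith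
    also have "\<dots> = c * (\<mu> * t + q)" using c\<mu> by (simp add: algebra_simps flip: mult.assoc)
    also have "\<dots> \<le> c * x" unfolding x_def using dm c by (intro mult_left_mono) auto
    finally have cx0: "0 \<le> c * x" .
    have "B\<^sup>2 / \<epsilon> \<le> z" using t \<epsilon> unfolding T_def z_def by linarith
    then have "B\<^sup>2 \<le> \<epsilon> * z" using \<epsilon> by (simp add: pos_divide_le_eq mult.commute)
    have "(\<Sum>i<s. (ln (d i))\<^sup>2) \<le> c\<^sup>2 * x\<^sup>2 + \<beta>\<^sup>2"
      using sq(1) s unfolding x_def \<beta>_def c_def by simp
    also have "\<dots> \<le> z\<^sup>2 + B\<^sup>2"
      using \<beta>B power_mono[OF cx cx0, of 2] by (simp add: power_mult_distrib)
    also have "\<dots> \<le> (z + \<epsilon> / 2)\<^sup>2" using \<open>B\<^sup>2 \<le> \<epsilon> * z\<close>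
      by (simp add: power2_sum mult.commute add_increasing)
    finally have "form_dist s Q ?R \<le> z + \<epsilon> / 2"
      unfolding P(6) using cx cx0 \<epsilon> by (intro real_le_lsqrt) auto
    then show "form_dist s Q ?R - t \<le> sqrt (real s / (real s - 1)) * ln (Q $$ (k,k)) + \<epsilon>"
      unfolding z_def c_def q_def by simp
  qed
qed

section \<open>Primitive integer vectors and the unimodular group\<close>

abbreviation rmat :: "int mat \<Rightarrow> real mat" where
  "rmat \<equiv> map_mat real_of_int"

abbreviation rvec :: "int vec \<Rightarrow> real vec" where
  "rvec \<equiv> map_vec real_of_int"

lemma SLZ_D:
  assumes "B \<in> SLZ s"
  shows "B \<in> carrier_mat s s" "det B = 1" "rmat B \<in> carrier_mat s s" "det (rmat B) = 1"
  using assms unfolding SLZ_def by (auto simp: of_int_hom.hom_det)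

lemma SLZ_one [simp]: "1\<^sub>m s \<in> SLZ s"
  unfolding SLZ_def by simp

lemma SLZ_mult: "A \<in> SLZ s \<Longrightarrow> B \<in> SLZ s \<Longrightarrow> A * B \<in> SLZ s"
  unfolding SLZ_def by (auto simp: det_mult[of _ s])

lemma SLZ_transpose: "A \<in> SLZ s \<Longrightarrow> A\<^sup>T \<in> SLZ s"
  unfolding SLZ_def by (auto simp: det_transpose[of _ s])

lemma SLZ_inverse:
  assumes "B \<in> SLZ s"
  obtains B' where "B' \<in> SLZ s" "B * B' = 1\<^sub>m s" "B' * B = 1\<^sub>m s"
proof -
  note B = SLZ_D[OF assms]
  have adj: "adj_mat B \<in> carrier_mat s s" "B * adj_mat B = 1\<^sub>m s" "adj_mat B * B = 1\<^sub>m s"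
    using adj_mat[OF B(1)] B(2) by auto
  have "det B * det (adj_mat B) = 1" using det_mult[OF B(1) adj(1)] adj(2) by simp
  then have "adj_mat B \<in> SLZ s" unfolding SLZ_def using adj(1) B(2) by simp
  with that adj show ?thesis by blast
qed

lemma rmat_mult:
  "A \<in> carrier_mat n n \<Longrightarrow> B \<in> carrier_mat n n \<Longrightarrow> rmat (A * B) = rmat A * rmat B"
  by (rule of_int_hom.mat_hom_mult)

lemma rmat_mult_rvec:
  "A \<in> carrier_mat n n \<Longrightarrow> v \<in> carrier_vec n \<Longrightarrow> rmat A *\<^sub>v rvec v = rvec (A *\<^sub>v v)"
  by (rule of_int_hom.mult_mat_vec_hom[symmetric])

text \<open>Equivalently, the entries have greatest common divisor one. Phrased by divisibility, the property
is visibly preserved by integer matrices with an integer inverse.\<close>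

definition primitive_vecs :: "nat \<Rightarrow> int vec set" where
  "primitive_vecs s = {w \<in> carrier_vec s. \<forall>d. (\<forall>i<s. d dvd w $ i) \<longrightarrow> is_unit d}"

lemma primitive_vecsD:
  assumes "w \<in> primitive_vecs s"
  shows "w \<in> carrier_vec s" "\<And>d. (\<And>i. i < s \<Longrightarrow> d dvd w $ i) \<Longrightarrow> is_unit d"
  using assms unfolding primitive_vecs_def by auto

lemma primitive_nonzero:
  assumes "w \<in> primitive_vecs s"
  shows "\<exists>i<s. w $ i \<noteq> 0"
proof (rule ccontr)
  assume "\<not> ?thesis"
  then have "is_unit (2 :: int)" by (intro primitive_vecsD(2)[OF assms]) auto
  then show False by simp
qed

lemma unit_vec_primitive:
  assumes "k < s"
  shows "unit_vec s k \<in> primitive_vecs s"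
proof -
  have "is_unit d" if d: "\<forall>i<s. d dvd (unit_vec s k :: int vec) $ i" for d
    using d[rule_format, OF assms] assms by simp
  then show ?thesis unfolding primitive_vecs_def by auto
qed

lemma SLZ_primitive:
  assumes B: "B \<in> SLZ s" and w: "w \<in> primitive_vecs s"
  shows "B *\<^sub>v w \<in> primitive_vecs s"
proof -
  note BD = SLZ_D[OF B] and wD = primitive_vecsD[OF w]
  obtain B' where B': "B' \<in> SLZ s" "B' * B = 1\<^sub>m s" using SLZ_inverse[OF B] by metis
  note B'D = SLZ_D[OF B'(1)]
  have w_eq: "B' *\<^sub>v (B *\<^sub>v w) = w"
    using assoc_mult_mat_vec[OF B'D(1) BD(1) wD(1)] B'(2) wD(1) by simp
  have "is_unit d" if d: "\<forall>i<s. d dvd (B *\<^sub>v w) $ i" for d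
  proof (rule wD(2))
    fix i assume i: "i < s"
    have "(B' *\<^sub>v (B *\<^sub>v w)) $ i = (\<Sum>j<s. B' $$ (i,j) * (B *\<^sub>v w) $ j)"
      using i BD(1) B'D(1) by (auto simp: scalar_prod_def atLeast0LessThan intro!: sum.cong)
    also have "d dvd \<dots>" using d by (intro dvd_sum) auto
    finally show "d dvd w $ i" unfolding w_eq .
  qed
  then show ?thesis unfolding primitive_vecs_def using BD(1) wD(1) by auto
qed

lemma addrow_mat_SLZ: "i \<noteq> j \<Longrightarrow> addrow_mat s c i j \<in> SLZ s"
  unfolding SLZ_def by (auto simp: det_addrow_mat)

lemma addrow_mat_vec:
  fixes w :: "int vec"
  assumes w: "w \<in> carrier_vec s" and ij: "i < s" "j < s" "i \<noteq> j" and l: "l < s"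
  shows "(addrow_mat s c i j *\<^sub>v w) $ l = (if l = i then w $ i + c * w $ j else w $ l)"
proof -
  have "(addrow_mat s c i j *\<^sub>v w) $ l = (\<Sum>m<s. addrow_mat s c i j $$ (l,m) * w $ m)"
    using w l by (auto simp: scalar_prod_def atLeast0LessThan intro!: sum.cong)
  also have "\<dots> = (\<Sum>m<s. (if m = l then w $ m else 0) + (if m = j then if l = i then c * w $ m else 0 else 0))"
    using l ij by (intro sum.cong) auto
  also have "\<dots> = (if l = i then w $ i + c * w $ j else w $ l)"
    using l ij by (simp add: sum.distrib)
  finally show ?thesis .
qed

text \<open>One subtraction of the Euclidean algorithm, with the sign chosen to decrease the absolute value.\<close>

lemma sgn_step:
  fixes x y :: int
  assumes "y \<noteq> 0" "\<bar>y\<bar> \<le> \<bar>x\<bar>"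
  shows "\<bar>x + (- (sgn x * sgn y)) * y\<bar> < \<bar>x\<bar>"
  using assms by (cases "x > 0"; cases "y > 0") (auto simp: sgn_if)

text \<open>The Euclidean algorithm by elementary row operations, each of which is unimodular. It ends with a
vector having a single nonzero entry, which is \<open>1\<close> or \<open>-1\<close> by primitivity; a second coordinate,
available since \<open>s \<ge> 2\<close>, serves to adjust its position and sign.\<close>

lemma primitive_vec_is_column:
  assumes s: "s \<ge> 2" and k: "k < s" and w: "w \<in> primitive_vecs s"
  shows "\<exists>B\<in>SLZ s. B *\<^sub>v unit_vec s k = w"
proof -
  define R where "R v \<longleftrightarrow> (\<exists>B\<in>SLZ s. B *\<^sub>v unit_vec s k = v)" for v :: "int vec"
  have R_mult: "R (A *\<^sub>v v)" if A: "A \<in> SLZ s" and v: "R v" for A v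
  proof -
    obtain B where B: "B \<in> SLZ s" "B *\<^sub>v unit_vec s k = v" using v R_def by blast
    have "(A * B) *\<^sub>v unit_vec s k = A *\<^sub>v v"
      using assoc_mult_mat_vec[OF SLZ_D(1)[OF A] SLZ_D(1)[OF B(1)] unit_vec_carrier, of k] B(2) by simp
    with SLZ_mult[OF A B(1)] show ?thesis unfolding R_def by blast
  qed
  have R_cancel: "R v" if A: "A \<in> SLZ s" and v: "v \<in> carrier_vec s" "R (A *\<^sub>v v)" for A v
  proof -
    obtain A' where A': "A' \<in> SLZ s" "A' * A = 1\<^sub>m s" using SLZ_inverse[OF A] by metis
    have "A' *\<^sub>v (A *\<^sub>v v) = v"
      using assoc_mult_mat_vec[OF SLZ_D(1)[OF A'(1)] SLZ_D(1)[OF A] v(1)] A'(2) v(1) by simp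
    with R_mult[OF A'(1) v(2)] show ?thesis by simp
  qed
  have R_move: "R (a \<cdot>\<^sub>v unit_vec s i)"
    if R: "R (u \<cdot>\<^sub>v unit_vec s j)" and ij: "i < s" "j < s" "i \<noteq> j" and ua: "u * u = 1" "a * a = 1"
    for u a :: int and i j
  proof -
    \<comment> \<open>From \<open>u e\<^sub>j\<close> first create the entry \<open>a\<close> at position \<open>i\<close>, then use it to clear position \<open>j\<close>.\<close>
    let ?v = "addrow_mat s (a * u) i j *\<^sub>v (u \<cdot>\<^sub>v unit_vec s j)"
    let ?v' = "addrow_mat s (- (u * a)) j i *\<^sub>v ?v"
    have "R ?v'" using R_mult addrow_mat_SLZ ij R by simp
    moreover have "?v' = a \<cdot>\<^sub>v unit_vec s i"
    proof (rule eq_vecI)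
      fix l assume "l < dim_vec (a \<cdot>\<^sub>v unit_vec s i)"
      then have l: "l < s" by simp
      have 1: "(u \<cdot>\<^sub>v unit_vec s j) \<in> carrier_vec s" "?v \<in> carrier_vec s"
        by (auto intro!: mult_mat_vec_carrier[OF addrow_mat_carrier])
      show "?v' $ l = (a \<cdot>\<^sub>v unit_vec s i) $ l"
        unfolding addrow_mat_vec[OF 1(2) ij(2,1) ij(3)[symmetric] l]
          addrow_mat_vec[OF 1(1) ij l] addrow_mat_vec[OF 1(1) ij ij(1)] addrow_mat_vec[OF 1(1) ij ij(2)]
        using l ij ua by (auto simp: mult.assoc)
    qed simp
    ultimately show ?thesis by simp
  qed
  \<comment> \<open>If the position is already \<open>k\<close>, a detour over another coordinate corrects the sign.\<close>
  have R_unit: "R (a \<cdot>\<^sub>v unit_vec s i)" if i: "i < s" and a: "a * a = 1" for a i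
  proof -
    have k1: "R (1 \<cdot>\<^sub>v unit_vec s k)" unfolding R_def by (intro bexI[of _ "1\<^sub>m s"]) auto
    show ?thesis
    proof (cases "i = k")
      case False
      then show ?thesis using R_move[OF k1 i k] a by simp
    next
      case True
      define l where "l = (if k = 0 then 1 else 0 :: nat)"
      have l: "l < s" "l \<noteq> k" using s unfolding l_def by auto
      have "R (1 \<cdot>\<^sub>v unit_vec s l)" using R_move[OF k1 l(1) k l(2), of 1] by simp
      from R_move[OF this k l(1) l(2)[symmetric] _ a] show ?thesis using True by simp
    qed
  qed
  have "R w" using w
  proof (induction "\<Sum>l<s. nat \<bar>w $ l\<bar>" arbitrary: w rule: less_induct)
    case less
    note wD = primitive_vecsD[OF less.prems]
    show ?case
    proof (cases "\<exists>i<s. \<exists>j<s. i \<noteq> j \<and> w $ i \<noteq> 0 \<and> w $ j \<noteq> 0")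
      case True
      then obtain i j where ij: "i < s" "j < s" "i \<noteq> j" "w $ j \<noteq> 0" "\<bar>w $ j\<bar> \<le> \<bar>w $ i\<bar>"
        by (metis linear)
      define E where "E = addrow_mat s (- (sgn (w $ i) * sgn (w $ j))) i j"
      have E: "E \<in> SLZ s" unfolding E_def by (rule addrow_mat_SLZ[OF ij(3)])
      have Ew: "(E *\<^sub>v w) $ l = (if l = i then w $ i + (- (sgn (w $ i) * sgn (w $ j))) * w $ j else w $ l)"
        if "l < s" for l unfolding E_def by (rule addrow_mat_vec[OF wD(1) ij(1-3) that])
      have "(\<Sum>l<s. nat \<bar>(E *\<^sub>v w) $ l\<bar>) < (\<Sum>l<s. nat \<bar>w $ l\<bar>)"
      proof (rule sum_strict_mono_ex1)
        have i: "nat \<bar>(E *\<^sub>v w) $ i\<bar> < nat \<bar>w $ i\<bar>"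
          using sgn_step[OF ij(4,5)] Ew[OF ij(1)] by simp
        then show "\<exists>l\<in>{..<s}. nat \<bar>(E *\<^sub>v w) $ l\<bar> < nat \<bar>w $ l\<bar>" using ij(1) by auto
        show "\<forall>l\<in>{..<s}. nat \<bar>(E *\<^sub>v w) $ l\<bar> \<le> nat \<bar>w $ l\<bar>"
        proof
          fix l assume "l \<in> {..<s}"
          then show "nat \<bar>(E *\<^sub>v w) $ l\<bar> \<le> nat \<bar>w $ l\<bar>"
            using i Ew[of l] by (cases "l = i") auto
        qed
      qed simp
      from less.hyps[OF this SLZ_primitive[OF E less.prems]]
      show ?thesis by (rule R_cancel[OF E wD(1)])
    next
      case False
      obtain i where i: "i < s" "w $ i \<noteq> 0" using primitive_nonzero[OF less.prems] by blast
      have zero: "w $ j = 0" if "j < s" "j \<noteq> i" for j using False i that by blast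
      have "is_unit (w $ i)"
      proof (rule wD(2))
        fix j assume "j < s" then show "w $ i dvd w $ j" using zero[of j] by (cases "j = i") auto
      qed
      then have "w $ i * w $ i = 1" using zmult_eq_1_iff by auto
      moreover have "w = w $ i \<cdot>\<^sub>v unit_vec s i"
        by (rule eq_vecI) (use wD(1) i zero in \<open>auto simp: unit_vec_def\<close>)
      ultimately show ?thesis using R_unit[OF i(1)] by metis
    qed
  qed
  then show ?thesis unfolding R_def .
qed

text \<open>A nonzero integer vector has length at least one. Together with
\<open>posdef_qf_ge_norm\<close> this bounds the infimum \<open>log_min\<close> from below.\<close>

lemma rvec_norm_ge_1:
  assumes "w \<in> primitive_vecs s"
  shows "qf (1\<^sub>m s) (rvec w) \<ge> 1"
proof -
  note wD = primitive_vecsD[OF assms]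
  have c: "rvec w \<in> carrier_vec s" using wD(1) by simp
  obtain i where i: "i < s" "w $ i \<noteq> 0" using primitive_nonzero[OF assms] by blast
  then have "1 \<le> (w $ i)\<^sup>2" by (metis int_one_le_iff_zero_less zero_less_power2)
  then have "1 \<le> (rvec w $ i)\<^sup>2" using i(1) wD(1) by (simp flip: of_int_power)
  also have "\<dots> \<le> (\<Sum>i<s. (rvec w $ i)\<^sup>2)" by (rule member_le_sum) (use i in auto)
  finally show ?thesis unfolding qf_one[OF c] .
qed

lemma rvec_primitive_nonzero:
  assumes "w \<in> primitive_vecs s"
  shows "rvec w \<in> carrier_vec s" "rvec w \<noteq> 0\<^sub>v s"
proof -
  show c: "rvec w \<in> carrier_vec s" using primitive_vecsD[OF assms] by simp
  show "rvec w \<noteq> 0\<^sub>v s"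
  proof
    assume "rvec w = 0\<^sub>v s"
    with rvec_norm_ge_1[OF assms] show False by (simp add: qf_one)
  qed
qed

definition log_min :: "nat \<Rightarrow> real mat \<Rightarrow> real" where
  "log_min s Q = (INF w\<in>primitive_vecs s. ln (qf Q (rvec w)))"

lemma log_qf_bdd_below:
  assumes Q: "posdef_mat s Q"
  shows "bdd_below ((\<lambda>w. ln (qf Q (rvec w))) ` primitive_vecs s)"
proof -
  obtain K where K: "K > 0" "\<And>v. v \<in> carrier_vec s \<Longrightarrow> qf (1\<^sub>m s) v \<le> K * qf Q v"
    using posdef_qf_ge_norm[OF Q] by blast
  show ?thesis
  proof (rule bdd_belowI2)
    fix w assume w: "w \<in> primitive_vecs s"
    have "1 \<le> K * qf Q (rvec w)"
      using rvec_norm_ge_1[OF w] K(2)[OF rvec_primitive_nonzero(1)[OF w]] by linarith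
    then have "1 / K \<le> qf Q (rvec w)" using K(1) by (simp add: divide_le_eq mult.commute)
    then show "ln (1 / K) \<le> ln (qf Q (rvec w))" using K(1) by (intro ln_mono) auto
  qed
qed

lemma log_min_le:
  assumes "posdef_mat s Q" "w \<in> primitive_vecs s"
  shows "log_min s Q \<le> ln (qf Q (rvec w))"
  unfolding log_min_def by (rule cINF_lower[OF log_qf_bdd_below[OF assms(1)] assms(2)])

section \<open>Hermite reduction and duality\<close>

lemma log_min_approx:
  assumes Q: "posdef_mat s Q" and s: "s > 0" and e: "e > 0"
  obtains w where "w \<in> primitive_vecs s" "ln (qf Q (rvec w)) < log_min s Q + e"
proof -
  have ne: "primitive_vecs s \<noteq> {}" using unit_vec_primitive[OF s] by blast
  have "log_min s Q < log_min s Q + e" using e by simp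
  then show ?thesis using that
    unfolding log_min_def using cINF_less_iff[OF ne log_qf_bdd_below[OF Q]] by blast
qed

lemma qf_rvec_pos:
  assumes "posdef_mat s Q" "w \<in> primitive_vecs s"
  shows "qf Q (rvec w) > 0"
  using posdef_matD(3)[OF assms(1)] rvec_primitive_nonzero[OF assms(2)] by blast

lemma form_act_SLZ:
  assumes Q: "posdef_mat s Q" and B: "B \<in> SLZ s"
  shows "posdef_mat s (form_act Q (rmat B))" "det (form_act Q (rmat B)) = det Q"
    "w \<in> carrier_vec s \<Longrightarrow> qf (form_act Q (rmat B)) (rvec w) = qf Q (rvec (B *\<^sub>v w))"
proof -
  note D = posdef_matD[OF Q] and BD = SLZ_D[OF B]
  show "posdef_mat s (form_act Q (rmat B))" by (rule posdef_form_act[OF Q BD(3)]) (simp add: BD(2))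
  show "det (form_act Q (rmat B)) = det Q" unfolding det_form_act[OF D(1) BD(3)] BD(4) by simp
  assume w: "w \<in> carrier_vec s"
  then have "rvec w \<in> carrier_vec s" by simp
  from qf_form_act[OF D(1) BD(3) this] rmat_mult_rvec[OF BD(1) w]
  show "qf (form_act Q (rmat B)) (rvec w) = qf Q (rvec (B *\<^sub>v w))" by simp
qed

lemma rvec_unit_vec: "rvec (unit_vec n k) = unit_vec n k"
  by (rule eq_vecI) (auto simp: unit_vec_def)

lemma rvec_vCons: "rvec (vCons x y) = vCons (real_of_int x) (rvec y)"
  by (rule eq_vecI) (auto simp: vec_index_vCons)

lemma vCons_primitive:
  assumes "y \<in> primitive_vecs n"
  shows "vCons x y \<in> primitive_vecs (Suc n)"
proof -
  note yD = primitive_vecsD[OF assms]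
  have "is_unit d" if d: "\<forall>i<Suc n. d dvd vCons x y $ i" for d
  proof (rule yD(2))
    fix i assume "i < n"
    then show "d dvd y $ i" using d[rule_format, of "Suc i"] yD(1) by simp
  qed
  then show ?thesis unfolding primitive_vecs_def using yD(1) by auto
qed

text \<open>Hermite's argument. Choose a primitive vector \<open>v\<close> at which \<open>Q\<close> is minimal up to a factor two, make
it the first basis vector and complete the square: \<open>Q = a t\<^sup>2 + S(y)\<close> with \<open>a = Q(v)\<close> and
\<open>a * det S = det Q\<close>. By induction \<open>S\<close> takes a small value at some primitive \<open>y\<close>; a suitable
integer first coordinate gives \<open>\<bar>t\<bar> \<le> 1/2\<close>. Near-minimality then forces \<open>a \<le> 4 * S(y)\<close>. The
inequality is stated with the \<open>n\<close>-th power of the value, so that no roots occur.\<close>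

lemma hermite_bound:
  assumes "n \<ge> 1"
  shows "\<exists>C>0. \<forall>Q. posdef_mat n Q \<longrightarrow>
    (\<exists>w\<in>primitive_vecs n. qf Q (rvec w) ^ n \<le> C * det Q)"
  using assms
proof (induction n rule: nat_induct_at_least)
  case base
  have "\<exists>w\<in>primitive_vecs 1. qf Q (rvec w) ^ 1 \<le> 1 * det Q" if Q: "posdef_mat 1 Q" for Q
  proof (intro bexI)
    show "unit_vec 1 0 \<in> primitive_vecs 1" by (rule unit_vec_primitive) simp
    have "det Q = Q $$ (0,0)" using det_single[of Q] posdef_matD(1)[OF Q] by simp
    then show "qf Q (rvec (unit_vec 1 0)) ^ 1 \<le> 1 * det Q"
      unfolding rvec_unit_vec using qf_unit[OF posdef_matD(1)[OF Q], of 0] by simp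
  qed
  then show ?case by (intro exI[of _ 1]) auto
next
  case (Suc n)
  then obtain C where C: "C > 0"
    "\<And>Q. posdef_mat n Q \<Longrightarrow> \<exists>w\<in>primitive_vecs n. qf Q (rvec w) ^ n \<le> C * det Q" by blast
  have "\<exists>v\<in>primitive_vecs (Suc n). qf Q (rvec v) ^ Suc n \<le> (4 ^ n * C) * det Q"
    if Q: "posdef_mat (Suc n) Q" for Q
  proof -
    obtain v where v: "v \<in> primitive_vecs (Suc n)"
      "ln (qf Q (rvec v)) < log_min (Suc n) Q + ln 2"
      using log_min_approx[OF Q, of "ln 2"] by auto
    have min: "qf Q (rvec v) \<le> 2 * qf Q (rvec w)" if w: "w \<in> primitive_vecs (Suc n)" for w
    proof -
      have "ln (qf Q (rvec v)) \<le> ln (qf Q (rvec w)) + ln 2"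
        using v(2) log_min_le[OF Q w] by linarith
      also have "\<dots> = ln (2 * qf Q (rvec w))"
        using qf_rvec_pos[OF Q w] by (simp add: ln_mult)
      finally show ?thesis
        using qf_rvec_pos[OF Q w] qf_rvec_pos[OF Q v(1)] by (subst (asm) ln_le_cancel_iff) auto
    qed
    obtain B where B: "B \<in> SLZ (Suc n)" "B *\<^sub>v unit_vec (Suc n) 0 = v"
      using primitive_vec_is_column[of "Suc n" 0 v] Suc.hyps v(1) by auto
    let ?Q = "form_act Q (rmat B)"
    note P = form_act_SLZ[OF Q B(1)]
    define a where "a = ?Q $$ (0,0)"
    have a: "a = qf Q (rvec v)"
      using qf_unit[OF posdef_matD(1)[OF P(1)], of 0] P(3)[of "unit_vec (Suc n) 0"] B(2)
      unfolding a_def rvec_unit_vec by simp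
    obtain U S b where U: "U \<in> carrier_mat (Suc n) (Suc n)" "det U = 1" "b \<in> carrier_vec n"
      "\<And>x y. y \<in> carrier_vec n \<Longrightarrow> U *\<^sub>v vCons x y = vCons (x - b \<bullet> y) y"
      "form_act ?Q U = block_sum a S" "posdef_mat n S"
      using gauss_step[OF P(1)] unfolding a_def by metis
    note SD = posdef_matD[OF U(6)]
    have det: "a * det S = det Q"
      using det_form_act[OF posdef_matD(1)[OF P(1)] U(1)] unfolding U(5) U(2) det_block_sum[OF SD(1)] P(2)
      by simp
    obtain y where y: "y \<in> primitive_vecs n" "qf S (rvec y) ^ n \<le> C * det S"
      using C(2)[OF U(6)] by blast
    have yc: "y \<in> carrier_vec n" "rvec y \<in> carrier_vec n" using primitive_vecsD(1)[OF y(1)] by auto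
    \<comment> \<open>After completing the square the first coordinate of \<open>(x0, y)\<close> becomes \<open>t\<close>.\<close>
    define x0 where "x0 = - round (b \<bullet> rvec y)"
    define t where "t = real_of_int x0 + b \<bullet> rvec y"
    have "\<bar>t\<bar> \<le> 1 / 2" unfolding t_def x0_def
      using of_int_round_abs_le[of "b \<bullet> rvec y"] by (simp add: abs_minus_commute)
    then have t: "t\<^sup>2 \<le> 1 / 4" using power_mono[of "\<bar>t\<bar>" "1/2" 2] by (simp add: power2_eq_square)
    let ?w = "vCons x0 y"
    have w: "?w \<in> primitive_vecs (Suc n)" by (rule vCons_primitive[OF y(1)])
    have "U *\<^sub>v vCons t (rvec y) = rvec ?w"
      unfolding U(4)[OF yc(2)] rvec_vCons t_def by simp
    then have "qf ?Q (rvec ?w) = qf (form_act ?Q U) (vCons t (rvec y))"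
      using qf_form_act[OF posdef_matD(1)[OF P(1)] U(1), of "vCons t (rvec y)"] yc(2) by simp
    also have "\<dots> = a * t\<^sup>2 + qf S (rvec y)"
      unfolding U(5) by (rule qf_block_sum[OF SD(1) yc(2)])
    also have "qf ?Q (rvec ?w) = qf Q (rvec (B *\<^sub>v ?w))"
      by (rule P(3)) (use yc in simp)
    finally have "qf Q (rvec (B *\<^sub>v ?w)) = a * t\<^sup>2 + qf S (rvec y)" .
    then have "a \<le> 2 * (a * t\<^sup>2 + qf S (rvec y))"
      using min[OF SLZ_primitive[OF B(1) w]] a by simp
    moreover have a0: "a > 0" unfolding a by (rule qf_rvec_pos[OF Q v(1)])
    then have "a * t\<^sup>2 \<le> a * (1 / 4)" using t by (intro mult_left_mono) auto
    ultimately have "a \<le> 4 * qf S (rvec y)" by simp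
    then have "a ^ n \<le> (4 * qf S (rvec y)) ^ n" using a0 by (intro power_mono) auto
    also have "\<dots> \<le> 4 ^ n * (C * det S)" using y(2) by (simp add: power_mult_distrib)
    finally have "a * a ^ n \<le> a * (4 ^ n * (C * det S))" using a0 by (intro mult_left_mono) auto
    also have "\<dots> = (4 ^ n * C) * (a * det S)" by (simp add: mult_ac)
    finally have "a ^ Suc n \<le> (4 ^ n * C) * det Q" unfolding det by simp
    then show ?thesis using v(1) unfolding a by blast
  qed
  then show ?case using C(1) by (intro exI[of _ "4 ^ n * C"]) auto
qed

text \<open>The inverse transpose. If \<open>Q\<close> and \<open>R\<close> are inverse to each other, they remain so when \<open>Q\<close> is moved
by \<open>B\<close> and \<open>R\<close> by the contragredient of \<open>B\<close>.\<close>

lemma contragredient: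
  assumes B: "B \<in> SLZ s"
  obtains A where "A \<in> SLZ s" "\<And>Q R. Q \<in> carrier_mat s s \<Longrightarrow> R \<in> carrier_mat s s \<Longrightarrow> Q * R = 1\<^sub>m s \<Longrightarrow>
    form_act Q (rmat B) * form_act R (rmat A) = 1\<^sub>m s"
proof -
  obtain B' where B': "B' \<in> SLZ s" "B * B' = 1\<^sub>m s" "B' * B = 1\<^sub>m s" using SLZ_inverse[OF B] .
  note BD = SLZ_D[OF B] and B'D = SLZ_D[OF B'(1)]
  let ?b = "rmat B" and ?b' = "rmat B'"
  note assoc = assoc_mult_mat[of _ s s _ s _ s]
  have t: "?b\<^sup>T \<in> carrier_mat s s" "?b'\<^sup>T \<in> carrier_mat s s" using BD B'D by auto
  have bb': "?b * ?b' = 1\<^sub>m s" using rmat_mult[OF BD(1) B'D(1)] B'(2) by (simp add: of_int_hom.mat_hom_one)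
  have b'b: "?b' * ?b = 1\<^sub>m s" using rmat_mult[OF B'D(1) BD(1)] B'(3) by (simp add: of_int_hom.mat_hom_one)
  show ?thesis
  proof (rule that[of "B'\<^sup>T"])
    show "B'\<^sup>T \<in> SLZ s" by (rule SLZ_transpose[OF B'(1)])
    fix Q R :: "real mat" assume Q: "Q \<in> carrier_mat s s" and R: "R \<in> carrier_mat s s" and QR: "Q * R = 1\<^sub>m s"
    have A: "rmat (B'\<^sup>T) = ?b'\<^sup>T" by (rule eq_matI) auto
    have RA: "form_act R (rmat (B'\<^sup>T)) = ?b' * (R * ?b'\<^sup>T)"
      unfolding form_act_def A using R B'D(3) t by (simp add: assoc)
    have RA': "R * ?b'\<^sup>T \<in> carrier_mat s s" using R t by simp
    have QB: "form_act Q ?b = (?b\<^sup>T * Q) * ?b" unfolding form_act_def ..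
    have btQ: "?b\<^sup>T * Q \<in> carrier_mat s s" using Q t by simp
    have "form_act Q ?b * form_act R (rmat (B'\<^sup>T)) = (?b\<^sup>T * Q) * (?b * (?b' * (R * ?b'\<^sup>T)))"
      unfolding QB RA by (rule assoc) (use btQ BD(3) B'D(3) RA' in auto)
    also have "?b * (?b' * (R * ?b'\<^sup>T)) = (?b * ?b') * (R * ?b'\<^sup>T)"
      by (rule assoc[symmetric]) (use BD(3) B'D(3) RA' in auto)
    also have "\<dots> = R * ?b'\<^sup>T" unfolding bb' by (rule left_mult_one_mat[OF RA'])
    also have "(?b\<^sup>T * Q) * (R * ?b'\<^sup>T) = ?b\<^sup>T * (Q * (R * ?b'\<^sup>T))"
      by (rule assoc) (use t Q RA' in auto)
    also have "Q * (R * ?b'\<^sup>T) = (Q * R) * ?b'\<^sup>T" by (rule assoc[symmetric]) (use t Q R in auto)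
    also have "\<dots> = ?b'\<^sup>T" unfolding QR using t by simp
    also have "?b\<^sup>T * ?b'\<^sup>T = (?b' * ?b)\<^sup>T" by (rule transpose_mult[symmetric]) (use BD B'D in auto)
    also have "\<dots> = 1\<^sub>m s" unfolding b'b by simp
    finally show "form_act Q ?b * form_act R (rmat (B'\<^sup>T)) = 1\<^sub>m s" .
  qed
qed

text \<open>Move \<open>v\<close> to the first basis vector. Then \<open>R(v)\<close> is a diagonal entry of the inverse of a form of
determinant one, hence by Cramer's rule the determinant of a minor of size \<open>s - 1\<close>, to which
Hermite's inequality applies. A zero in front of the vector found there brings it back to
dimension \<open>s\<close>.\<close>

lemma transference:
  assumes s: "s \<ge> 2"
  obtains C where "C > 0" "\<And>Q R v. posdef_mat s Q \<Longrightarrow> det Q = 1 \<Longrightarrow> R \<in> carrier_mat s s \<Longrightarrow> Q * R = 1\<^sub>m s \<Longrightarrow>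
    v \<in> primitive_vecs s \<Longrightarrow> \<exists>w\<in>primitive_vecs s. qf Q (rvec w) ^ (s - 1) \<le> C * qf R (rvec v)"
proof -
  obtain n where n: "s = Suc n" "n \<ge> 1" using s by (cases s) auto
  obtain C where C: "C > 0"
    "\<And>Q. posdef_mat n Q \<Longrightarrow> \<exists>w\<in>primitive_vecs n. qf Q (rvec w) ^ n \<le> C * det Q"
    using hermite_bound[OF n(2)] by blast
  show ?thesis
  proof (rule that[OF C(1)])
    fix Q R v
    assume Q: "posdef_mat s Q" "det Q = 1" and R: "R \<in> carrier_mat s s" "Q * R = 1\<^sub>m s"
      and v: "v \<in> primitive_vecs s"
    note D = posdef_matD[OF Q(1)]
    have RQ: "R * Q = 1\<^sub>m s" by (rule mat_mult_left_right_inverse[OF D(1) R])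
    have Rp: "posdef_mat s R" by (rule posdef_inverse[OF Q(1) R])
    have s0: "0 < s" using s by simp
    obtain B where B: "B \<in> SLZ s" "B *\<^sub>v unit_vec s 0 = v"
      using primitive_vec_is_column[OF s s0 v] by blast
    obtain A where A: "A \<in> SLZ s" and AB0: "\<And>Q R. Q \<in> carrier_mat s s \<Longrightarrow> R \<in> carrier_mat s s \<Longrightarrow> Q * R = 1\<^sub>m s \<Longrightarrow>
      form_act Q (rmat B) * form_act R (rmat A) = 1\<^sub>m s"
      using contragredient[OF B(1)] by blast
    note AB = AB0[OF R(1) D(1) RQ]
    let ?Q = "form_act Q (rmat A)" and ?R = "form_act R (rmat B)"
    note PQ = form_act_SLZ[OF Q(1) A] and PR = form_act_SLZ[OF Rp B(1)]
    have Qc: "?Q \<in> carrier_mat s s" and Rc: "?R \<in> carrier_mat s s"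
      using posdef_matD(1)[OF PQ(1)] posdef_matD(1)[OF PR(1)] by auto
    have adj: "adj_mat ?Q \<in> carrier_mat s s" "?Q * adj_mat ?Q = 1\<^sub>m s"
      using adj_mat[OF Qc] PQ(2) Q(2) by auto
    \<comment> \<open>The inverse of \<open>?Q\<close> is its adjugate, whose corner entry is a minor.\<close>
    have "?R = ?R * (?Q * adj_mat ?Q)" unfolding adj(2) using Rc by simp
    also have "\<dots> = (?R * ?Q) * adj_mat ?Q" by (rule assoc_mult_mat[OF Rc Qc adj(1), symmetric])
    also have "\<dots> = adj_mat ?Q" unfolding AB using adj(1) by simp
    finally have "?R $$ (0,0) = adj_mat ?Q $$ (0,0)" by simp
    also have "\<dots> = det (mat_delete ?Q 0 0)"
      unfolding adj_mat_def using Qc s0 by (simp add: cofactor_def)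
    finally have minor: "det (mat_delete ?Q 0 0) = qf R (rvec v)"
      using qf_unit[OF Rc s0] PR(3)[of "unit_vec s 0"] B(2) unfolding rvec_unit_vec by simp
    have Qn: "posdef_mat (Suc n) ?Q" using PQ(1) n(1) by simp
    obtain y where y: "y \<in> primitive_vecs n"
      "qf (mat_delete ?Q 0 0) (rvec y) ^ n \<le> C * det (mat_delete ?Q 0 0)"
      using C(2)[OF posdef_mat_delete[OF Qn]] by blast
    let ?w = "vCons 0 y"
    have w: "?w \<in> primitive_vecs s" unfolding n(1) by (rule vCons_primitive[OF y(1)])
    have yc: "rvec y \<in> carrier_vec n" using primitive_vecsD(1)[OF y(1)] by simp
    have "qf (mat_delete ?Q 0 0) (rvec y) = qf ?Q (rvec ?w)"
      using qf_vCons_0[OF posdef_matD(1)[OF Qn] yc] by (simp add: rvec_vCons)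
    also have "\<dots> = qf Q (rvec (A *\<^sub>v ?w))" by (rule PQ(3)[OF primitive_vecsD(1)[OF w]])
    finally have "qf Q (rvec (A *\<^sub>v ?w)) ^ (s - 1) \<le> C * qf R (rvec v)"
      using y(2) minor n(1) by simp
    then show "\<exists>w\<in>primitive_vecs s. qf Q (rvec w) ^ (s - 1) \<le> C * qf R (rvec v)"
      using SLZ_primitive[OF A w] by blast
  qed
qed

lemma log_min_transference:
  assumes s: "s \<ge> 2"
  obtains C where "\<And>Q R. posdef_mat s Q \<Longrightarrow> det Q = 1 \<Longrightarrow> R \<in> carrier_mat s s \<Longrightarrow> Q * R = 1\<^sub>m s \<Longrightarrow>
    (real s - 1) * log_min s Q \<le> log_min s R + C"
proof -
  obtain C where C: "C > 0" and tr: "\<And>Q R v. posdef_mat s Q \<Longrightarrow> det Q = 1 \<Longrightarrow> R \<in> carrier_mat s s \<Longrightarrow> Q * R = 1\<^sub>m s \<Longrightarrow>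
    v \<in> primitive_vecs s \<Longrightarrow> \<exists>w\<in>primitive_vecs s. qf Q (rvec w) ^ (s - 1) \<le> C * qf R (rvec v)"
    using transference[OF s] by blast
  show ?thesis
  proof (rule that[of "ln C"])
    fix Q R assume Q: "posdef_mat s Q" "det Q = 1" and R: "R \<in> carrier_mat s s" "Q * R = 1\<^sub>m s"
    have Rp: "posdef_mat s R" by (rule posdef_inverse[OF Q(1) R])
    have "(real s - 1) * log_min s Q - ln C \<le> log_min s R"
      unfolding log_min_def[of s R]
    proof (rule cINF_greatest)
      show "primitive_vecs s \<noteq> {}" using unit_vec_primitive[of 0 s] s by auto
      fix v assume v: "v \<in> primitive_vecs s"
      obtain w where w: "w \<in> primitive_vecs s" "qf Q (rvec w) ^ (s - 1) \<le> C * qf R (rvec v)"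
        using tr[OF Q R v] by blast
      have "(real s - 1) * log_min s Q \<le> (real s - 1) * ln (qf Q (rvec w))"
        using log_min_le[OF Q(1) w(1)] s by (intro mult_left_mono) auto
      also have "\<dots> = ln (qf Q (rvec w) ^ (s - 1))"
        using qf_rvec_pos[OF Q(1) w(1)] s by (simp add: ln_realpow of_nat_diff)
      also have "\<dots> \<le> ln (C * qf R (rvec v))"
        using w(2) qf_rvec_pos[OF Q(1) w(1)] qf_rvec_pos[OF Rp v] C
        by (subst ln_le_cancel_iff) auto
      also have "\<dots> = ln C + ln (qf R (rvec v))"
        using qf_rvec_pos[OF Rp v] C by (simp add: ln_mult)
      finally show "(real s - 1) * log_min s Q - ln C \<le> ln (qf R (rvec v))" by simp
    qed
    then show "(real s - 1) * log_min s Q \<le> log_min s R + ln C" by simp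
  qed
qed

section \<open>Busemann functions on the quotient\<close>

lemma quot_dist_lower:
  assumes "\<And>A B. A \<in> SLZ s \<Longrightarrow> B \<in> SLZ s \<Longrightarrow> r \<le> form_dist s (form_act Q (rmat A)) (form_act R (rmat B))"
  shows "r \<le> quot_dist s (form_proj s Q) (form_proj s R)"
  unfolding quot_dist_def form_proj_def
proof (rule cINF_greatest)
  have "SLZ s \<noteq> {}" using SLZ_one by blast
  then show "(\<lambda>B. form_act Q (rmat B)) ` SLZ s \<times> (\<lambda>B. form_act R (rmat B)) ` SLZ s \<noteq> {}" by simp
qed (use assms in auto)

lemma quot_dist_upper:
  assumes Q: "posdef_mat s Q" and R: "posdef_mat s R" and A: "A \<in> SLZ s" and B: "B \<in> SLZ s"
  shows "quot_dist s (form_proj s Q) (form_proj s R) \<le> form_dist s (form_act Q (rmat A)) (form_act R (rmat B))"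
proof -
  let ?S = "form_proj s Q \<times> form_proj s R"
  have bdd: "bdd_below ((\<lambda>(Q1, Q2). form_dist s Q1 Q2) ` ?S)"
  proof (rule bdd_belowI2)
    fix p assume "p \<in> ?S"
    then show "0 \<le> (case p of (Q1, Q2) \<Rightarrow> form_dist s Q1 Q2)"
      unfolding form_proj_def using form_dist_nonneg form_act_SLZ(1) Q R by auto
  qed
  have "(form_act Q (rmat A), form_act R (rmat B)) \<in> ?S" using A B unfolding form_proj_def by auto
  from cINF_lower[OF bdd this] show ?thesis unfolding quot_dist_def by simp
qed

text \<open>Inversion maps orbits to orbits, because the group is stable under the contragredient, and it
preserves the distance of forms.\<close>

lemma quot_dist_inverse:
  assumes Q1: "posdef_mat s Q1" and R1: "R1 \<in> carrier_mat s s" "Q1 * R1 = 1\<^sub>m s"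
    and Q2: "posdef_mat s Q2" and R2: "R2 \<in> carrier_mat s s" "Q2 * R2 = 1\<^sub>m s"
  shows "quot_dist s (form_proj s R1) (form_proj s R2) = quot_dist s (form_proj s Q1) (form_proj s Q2)"
proof -
  have le: "quot_dist s (form_proj s R1) (form_proj s R2) \<le> quot_dist s (form_proj s Q1) (form_proj s Q2)"
    if Q1: "posdef_mat s Q1" and R1: "R1 \<in> carrier_mat s s" "Q1 * R1 = 1\<^sub>m s"
    and Q2: "posdef_mat s Q2" and R2: "R2 \<in> carrier_mat s s" "Q2 * R2 = 1\<^sub>m s"
    for Q1 Q2 R1 R2
  proof (rule quot_dist_lower)
    fix A B assume A: "A \<in> SLZ s" and B: "B \<in> SLZ s"
    have P1: "posdef_mat s R1" and P2: "posdef_mat s R2"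
      using posdef_inverse[OF Q1 R1] posdef_inverse[OF Q2 R2] by auto
    obtain A' where A': "A' \<in> SLZ s" and A'0: "\<And>Q R. Q \<in> carrier_mat s s \<Longrightarrow> R \<in> carrier_mat s s \<Longrightarrow> Q * R = 1\<^sub>m s \<Longrightarrow>
      form_act Q (rmat A) * form_act R (rmat A') = 1\<^sub>m s"
      using contragredient[OF A] by blast
    obtain B' where B': "B' \<in> SLZ s" and B'0: "\<And>Q R. Q \<in> carrier_mat s s \<Longrightarrow> R \<in> carrier_mat s s \<Longrightarrow> Q * R = 1\<^sub>m s \<Longrightarrow>
      form_act Q (rmat B) * form_act R (rmat B') = 1\<^sub>m s"
      using contragredient[OF B] by blast
    have "form_dist s (form_act R1 (rmat A')) (form_act R2 (rmat B'))
        = form_dist s (form_act Q1 (rmat A)) (form_act Q2 (rmat B))"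
      by (rule form_dist_inverse[OF form_act_SLZ(1)[OF Q1 A] _
            A'0[OF posdef_matD(1)[OF Q1] R1] form_act_SLZ(1)[OF Q2 B] _ B'0[OF posdef_matD(1)[OF Q2] R2]])
         (use posdef_matD(1)[OF form_act_SLZ(1)[OF P1 A']] posdef_matD(1)[OF form_act_SLZ(1)[OF P2 B']] in auto)
    with quot_dist_upper[OF P1 P2 A' B']
    show "quot_dist s (form_proj s R1) (form_proj s R2)
      \<le> form_dist s (form_act Q1 (rmat A)) (form_act Q2 (rmat B))" by simp
  qed
  have P: "posdef_mat s R1" "posdef_mat s R2"
    using posdef_inverse[OF Q1 R1] posdef_inverse[OF Q2 R2] by auto
  have I: "R1 * Q1 = 1\<^sub>m s" "R2 * Q2 = 1\<^sub>m s"
    using mat_mult_left_right_inverse[OF posdef_matD(1)[OF Q1] R1]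
      mat_mult_left_right_inverse[OF posdef_matD(1)[OF Q2] R2] by auto
  show ?thesis
    by (rule antisym[OF le[OF Q1 R1 Q2 R2]
          le[OF P(1) posdef_matD(1)[OF Q1] I(1) P(2) posdef_matD(1)[OF Q2] I(2)]])
qed

text \<open>The lower bound holds for every \<open>t\<close>: for arbitrary points of the two orbits, apply
\<open>form_dist_lower_bound\<close> at the vector that the second unimodular matrix sends to the contracted
axis. The upper bound comes from a primitive vector nearly attaining the infimum and a unimodular
matrix having it as its \<open>k\<close>-th column.\<close>

lemma quot_dist_contracting_ray_tendsto:
  assumes s: "s \<ge> 2" and Q: "posdef_mat s Q" and det: "det Q = 1" and k: "k < s"
  shows "((\<lambda>t. quot_dist s (form_proj s Q) (form_proj s (contracting_ray s k t)) - t)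
    \<longlongrightarrow> sqrt (real s / (real s - 1)) * log_min s Q) at_top"
proof -
  define c where "c = sqrt (real s / (real s - 1))"
  define \<mu> where "\<mu> = sqrt ((real s - 1) / real s)"
  have c: "c > 0" unfolding c_def using s by simp
  have c\<mu>: "c * \<mu> = 1" unfolding c_def \<mu>_def by (rule contracting_ray_speed(2)[OF s])
  let ?g = "\<lambda>t. quot_dist s (form_proj s Q) (form_proj s (contracting_ray s k t)) - t"
  have lower: "c * log_min s Q \<le> ?g t" for t
  proof -
    let ?R = "contracting_ray s k t"
    have R: "posdef_mat s ?R" by (rule posdef_contracting_ray)
    have "c * log_min s Q + t \<le> quot_dist s (form_proj s Q) (form_proj s ?R)"
    proof (rule quot_dist_lower)
      fix A B assume A: "A \<in> SLZ s" and B: "B \<in> SLZ s"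
      note PA = form_act_SLZ[OF Q A] and PB = form_act_SLZ[OF R B]
      obtain B' where B': "B' \<in> SLZ s" "B * B' = 1\<^sub>m s" using SLZ_inverse[OF B] by metis
      define v where "v = B' *\<^sub>v unit_vec s k"
      have v: "v \<in> primitive_vecs s"
        unfolding v_def by (rule SLZ_primitive[OF B'(1) unit_vec_primitive[OF k]])
      note vc = primitive_vecsD(1)[OF v]
      have "B *\<^sub>v v = unit_vec s k"
        unfolding v_def using assoc_mult_mat_vec[OF SLZ_D(1)[OF B] SLZ_D(1)[OF B'(1)] unit_vec_carrier, of k] B'(2)
        by simp
      then have "qf (form_act ?R (rmat B)) (rvec v) = exp (- (\<mu> * t))"
        unfolding PB(3)[OF vc] \<mu>_def by (simp add: rvec_unit_vec qf_contracting_ray_unit[OF k])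
      moreover have "log_min s Q \<le> ln (qf (form_act Q (rmat A)) (rvec v))"
        unfolding PA(3)[OF vc] by (rule log_min_le[OF Q SLZ_primitive[OF A v]])
      moreover have "c * (ln (qf (form_act Q (rmat A)) (rvec v)) - ln (qf (form_act ?R (rmat B)) (rvec v)))
          \<le> form_dist s (form_act Q (rmat A)) (form_act ?R (rmat B))"
        unfolding c_def
        by (rule form_dist_lower_bound[OF s PA(1) PB(1) _ rvec_primitive_nonzero[OF v]])
           (simp add: PA(2) PB(2) det det_contracting_ray[OF s k])
      moreover have "c * log_min s Q + t = c * (log_min s Q - (- (\<mu> * t)))"
        using c\<mu> by (simp add: algebra_simps flip: mult.assoc)
      ultimately show "c * log_min s Q + t \<le> form_dist s (form_act Q (rmat A)) (form_act ?R (rmat B))"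
        using c by (smt (verit) ln_exp mult_left_mono)
    qed
    then show ?thesis by simp
  qed
  show ?thesis
    unfolding tendsto_iff c_def[symmetric]
  proof (intro allI impI)
    fix e :: real assume e: "e > 0"
    obtain w where w: "w \<in> primitive_vecs s" "ln (qf Q (rvec w)) < log_min s Q + e / (2 * c)"
      using log_min_approx[OF Q, of "e / (2 * c)"] s e c by auto
    obtain B where B: "B \<in> SLZ s" "B *\<^sub>v unit_vec s k = w"
      using primitive_vec_is_column[OF s k w(1)] by blast
    note PB = form_act_SLZ[OF Q B(1)]
    have kk: "form_act Q (rmat B) $$ (k,k) = qf Q (rvec w)"
      using qf_unit[OF posdef_matD(1)[OF PB(1)] k] PB(3)[of "unit_vec s k"] B(2)
      by (simp add: rvec_unit_vec)
    have "c * ln (qf Q (rvec w)) < c * (log_min s Q + e / (2 * c))"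
      using w(2) c by (intro mult_strict_left_mono) auto
    also have "\<dots> = c * log_min s Q + e / 2" using c by (simp add: field_simps)
    finally have cw: "c * ln (qf Q (rvec w)) < c * log_min s Q + e / 2" .
    have "e / 2 > 0" using e by simp
    from form_dist_contracting_ray_upper[OF s PB(1) _ k this] PB(2) det
    have "eventually (\<lambda>t. form_dist s (form_act Q (rmat B)) (contracting_ray s k t) - t
        \<le> c * ln (qf Q (rvec w)) + e / 2) at_top"
      unfolding kk c_def by simp
    then show "eventually (\<lambda>t. dist (?g t) (c * log_min s Q) < e) at_top"
    proof eventually_elim
      fix t assume t: "form_dist s (form_act Q (rmat B)) (contracting_ray s k t) - t
        \<le> c * ln (qf Q (rvec w)) + e / 2"
      have R: "posdef_mat s (contracting_ray s k t)" by (rule posdef_contracting_ray)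
      have "form_act (contracting_ray s k t) (rmat (1\<^sub>m s)) = contracting_ray s k t"
        using posdef_matD(1)[OF R] by (simp add: of_int_hom.mat_hom_one)
      then have "?g t < c * log_min s Q + e"
        using quot_dist_upper[OF Q R B(1) SLZ_one] t cw by simp
      with lower[of t] show "dist (?g t) (c * log_min s Q) < e" by (simp add: dist_real_def)
    qed
  qed
qed

lemma ray_1_eq_contracting_ray:
  assumes "s \<ge> 2"
  shows "ray s 1 t = contracting_ray s (s - 1) t"
  unfolding ray_def contracting_ray_def
  by (rule eq_matI) (use assms in \<open>auto simp: mat_diag_def real_sqrt_divide\<close>)

text \<open>The last ray expands the first axis and contracts the others, so its inverse contracts the first.\<close>

lemma ray_inverse_contracting_ray:
  assumes "s \<ge> 2"
  shows "contracting_ray s 0 t * ray s (s - 1) t = 1\<^sub>m s"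
  unfolding ray_def contracting_ray_def mat_diag_diag
  by (rule eq_matI) (use assms in \<open>auto simp: mat_diag_def real_sqrt_divide of_nat_diff mult_exp_exp\<close>)

lemma busemann_first_ray:
  assumes s: "s \<ge> 2" and Q: "posdef_mat s Q" "det Q = 1"
  shows "busemann s 1 (form_proj s Q) = sqrt (real s / (real s - 1)) * log_min s Q"
  unfolding busemann_def quot_ray_def ray_1_eq_contracting_ray[OF s]
  by (rule tendsto_Lim[OF _ quot_dist_contracting_ray_tendsto[OF s Q]]) (use s in auto)

lemma busemann_last_ray:
  assumes s: "s \<ge> 2" and Q: "posdef_mat s Q" "det Q = 1" and R: "R \<in> carrier_mat s s" "Q * R = 1\<^sub>m s"
  shows "busemann s (s - 1) (form_proj s Q) = sqrt (real s / (real s - 1)) * log_min s R"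
proof -
  note D = posdef_matD[OF Q(1)]
  have Rp: "posdef_mat s R" by (rule posdef_inverse[OF Q(1) R])
  have RQ: "R * Q = 1\<^sub>m s" by (rule mat_mult_left_right_inverse[OF D(1) R])
  have detR: "det R = 1" using det_mult[OF D(1) R(1)] R(2) Q(2) by simp
  have ray: "ray s (s - 1) t \<in> carrier_mat s s" for t unfolding ray_def by simp
  have "quot_dist s (form_proj s Q) (quot_ray s (s - 1) t)
      = quot_dist s (form_proj s R) (form_proj s (contracting_ray s 0 t))" for t
    unfolding quot_ray_def
    by (rule quot_dist_inverse[OF Rp D(1) RQ posdef_contracting_ray ray ray_inverse_contracting_ray[OF s]])
  then show ?thesis unfolding busemann_def
    using tendsto_Lim[OF _ quot_dist_contracting_ray_tendsto[OF s Rp detR, of 0]] s by simp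
qed

theorem proposition2p5p2:
  fixes s :: nat
  assumes "s \<ge> 2"
  shows "\<exists>C::real. C \<ge> 0 \<and> (\<forall>x \<in> form_quotient s.
           (real s - 1) * busemann s (s - 1) x - C \<le> busemann s 1 x \<and>
           busemann s 1 x \<le> 1 / (real s - 1) * busemann s (s - 1) x + C)"
proof -
  define c where "c = sqrt (real s / (real s - 1))"
  have c: "c > 0" unfolding c_def using assms by simp
  have s1: "real s - 1 \<ge> 1" using assms by simp
  obtain C where C: "\<And>Q R. posdef_mat s Q \<Longrightarrow> det Q = 1 \<Longrightarrow> R \<in> carrier_mat s s \<Longrightarrow> Q * R = 1\<^sub>m s \<Longrightarrow>
    (real s - 1) * log_min s Q \<le> log_min s R + C"
    using log_min_transference[OF assms] by blast
  have "(real s - 1) * busemann s (s - 1) x - c * \<bar>C\<bar> \<le> busemann s 1 x \<and>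
      busemann s 1 x \<le> 1 / (real s - 1) * busemann s (s - 1) x + c * \<bar>C\<bar>"
    if mem: "x \<in> form_quotient s" for x
  proof -
    obtain Q where Q: "posdef_mat s Q" "det Q = 1" and x: "x = form_proj s Q"
      using mem unfolding form_quotient_def forms_def by auto
    note D = posdef_matD[OF Q(1)]
    obtain R where R: "R \<in> carrier_mat s s" "Q * R = 1\<^sub>m s" "R * Q = 1\<^sub>m s"
      using inverse_mat_exists[OF D(1) posdef_det_nonzero[OF Q(1)]] by metis
    have Rp: "posdef_mat s R" by (rule posdef_inverse[OF Q(1) R(1,2)])
    have detR: "det R = 1" using det_mult[OF D(1) R(1)] R(2) Q(2) by simp
    have b1: "busemann s 1 x = c * log_min s Q"
      unfolding x c_def by (rule busemann_first_ray[OF assms Q])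
    have b2: "busemann s (s - 1) x = c * log_min s R"
      unfolding x c_def by (rule busemann_last_ray[OF assms Q R(1,2)])
    have "c * ((real s - 1) * log_min s R) \<le> c * (log_min s Q + \<bar>C\<bar>)"
      using C[OF Rp detR D(1) R(3)] c by (intro mult_left_mono) auto
    then have 1: "(real s - 1) * busemann s (s - 1) x \<le> busemann s 1 x + c * \<bar>C\<bar>"
      unfolding b1 b2 by (simp add: algebra_simps)
    have "log_min s Q \<le> (log_min s R + C) / (real s - 1)"
      using C[OF Q R(1,2)] s1 by (simp add: le_divide_eq mult.commute)
    also have "\<dots> \<le> 1 / (real s - 1) * log_min s R + \<bar>C\<bar>"
    proof -
      have "C / (real s - 1) \<le> \<bar>C\<bar> / 1" using s1 by (intro frac_le) auto
      then show ?thesis by (simp add: add_divide_distrib)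
    qed
    finally have "c * log_min s Q \<le> c * (1 / (real s - 1) * log_min s R + \<bar>C\<bar>)"
      using c by (intro mult_left_mono) auto
    then have "busemann s 1 x \<le> 1 / (real s - 1) * busemann s (s - 1) x + c * \<bar>C\<bar>"
      unfolding b1 b2 by (simp add: algebra_simps)
    with 1 show ?thesis by simp
  qed
  moreover have "c * \<bar>C\<bar> \<ge> 0" using c by simp
  ultimately show ?thesis by blast
qed

end
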